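(* Let $p\in(\tfrac12,1)$. Starting from an empty \textsc{Lua} hashmap, perform $T$ operations according to the random insertion/deletion model described in the context. Then, with super-polynomially high probability in $T$, the insertion function of \textsc{Lua} is called $\Omega(T\log T)$ times. As a consequence, the expected running time of the whole process is $\Omega(T\log T)$.
   Context: \textbf{\textsc{Lua} hashmap.} A non-empty hashmap is an array of size $M=2^m$ ($m\ge 0$); each slot holds a key, a value and a link \emph{next} (index of the next slot of its chain, or nil). A slot is \emph{free} if it holds (nil key, nil value), \emph{used} if it holds (key, non-nil value), \emph{deleted} if it holds (key, nil value). A pointer lastfree is initialized to $M-1$ and only decreases. Search for $x$: start at slot Hash$(x)$ and follow next-links until $x$ or the end of the chain is found. Deletion of $x$: search for it and set its value to nil (the key and the next-link are kept). Insertion of a new key $x$ with value $y$: let $i=\mathrm{Hash}(x)$ (the main position). If slot $i$ is free or deleted, put $(x,y)$ there (keeping the next-link if the slot was deleted). Otherwise, look for a free slot: scan downwards from lastfree, decrementing it, skipping used and deleted slots, until a free slot is found. If none is found (lastfree leaves the array), a \emph{rehash} occurs: count the number $n$ of used slots, allocate a new hashmap of size $2^{m'}$ with $m'$ the smallest integer with $n+1\le 2^{m'}$, and reinsert all used (key,value) pairs and $(x,y)$ into it by calls to the insertion function (so a rehash costs one call per used key). If a free slot $f$ is found: if the key $x'$ at slot $i$ is at its main position, put $(x,y)$ at $f$ and link it as the second element of the chain starting at $i$; otherwise move the pair at $i$ to $f$ (updating its predecessor's link) and put $(x,y)$ at $i$ with nil next-link. Updating an existing key just changes its value. \textbf{Hashing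 model (simple uniform hashing).} In a hashmap of size $M$, hash values of distinct keys are independent uniform integers in $\{0,\dots,M-1\}$, resampled at each rehash. \textbf{Random operation model.} Fix $p\in(\tfrac12,1)$. Starting from an empty hashmap, $T$ operations are performed; each is independently an insertion of a new (non-integer) key with probability $p$ and a deletion with probability $1-p$, except that when the hashmap has no used key an insertion is always performed. A deletion removes (sets to nil the value of) a key chosen uniformly at random among the keys currently having a value. A property holds with super-polynomially high probability in $T$ if the probability it fails is at most $\exp(-T^{c})$ for some constant $c>0$ and all sufficiently large $T$. *)

theory Defs
  imports "HOL-Probability.Probability" "HOL-Library.Landau_Symbols"
begin

text \<open>\<open>None\<close> plays the role of nil.\<close>

record ('k, 'v) slot =
  skey :: "'k option"
  sval :: "'v option"
  snext :: "nat option"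

definition is_free :: "('k, 'v) slot \<Rightarrow> bool" where
  "is_free s \<longleftrightarrow> skey s = None \<and> sval s = None"

definition is_used :: "('k, 'v) slot \<Rightarrow> bool" where
  "is_used s \<longleftrightarrow> skey s \<noteq> None \<and> sval s \<noteq> None"

definition is_deleted :: "('k, 'v) slot \<Rightarrow> bool" where
  "is_deleted s \<longleftrightarrow> skey s \<noteq> None \<and> sval s = None"

text \<open>
  The field \<open>hash\<close> records the hash values that have been drawn so far for the current array.
  The hash value of a key is drawn the first time it is needed (see \<open>main_position\<close> below), and
  all values are forgotten when a new array is allocated.
\<close>

record ('k, 'v) hashmap =
  slots :: "('k, 'v) slot list"
  lastfree :: int
  hash :: "'k \<rightharpoonup> nat"

definition new_hashmap :: "nat \<Rightarrow> ('k, 'v) hashmap" where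
  "new_hashmap M =
     \<lparr>slots = replicate M \<lparr>skey = None, sval = None, snext = None\<rparr>,
      lastfree = int M - 1, hash = Map.empty\<rparr>"

text \<open>The empty hashmap has no slot at all, so the first insertion triggers a rehash.\<close>

definition empty_hashmap :: "('k, 'v) hashmap" where
  "empty_hashmap = new_hashmap 0"

definition used_keys :: "('k, 'v) hashmap \<Rightarrow> 'k set" where
  "used_keys t = {x. \<exists>s \<in> set (slots t). is_used s \<and> skey s = Some x}"

definition used_pairs :: "('k, 'v) hashmap \<Rightarrow> ('k \<times> 'v) list" where
  "used_pairs t = map (\<lambda>s. (the (skey s), the (sval s))) (filter is_used (slots t))"

text \<open>
  The slot indices met when following the next-links, starting from an optional index.
  The first numeric argument bounds the length of the walk; the number of slots is always enough,
  since chains have no cycle.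
\<close>

fun chain :: "('k, 'v) slot list \<Rightarrow> nat \<Rightarrow> nat option \<Rightarrow> nat list" where
  "chain xs b None = []"
| "chain xs 0 (Some i) = []"
| "chain xs (Suc b) (Some i) = i # chain xs b (snext (xs ! i))"

definition chain_of :: "('k, 'v) hashmap \<Rightarrow> 'k \<Rightarrow> nat list" where
  "chain_of t x = chain (slots t) (length (slots t)) (hash t x)"

text \<open>The number of elements of a list examined by a left-to-right search for \<open>P\<close>.\<close>

definition probes :: "('a \<Rightarrow> bool) \<Rightarrow> 'a list \<Rightarrow> nat" where
  "probes P js = min (length js) (Suc (length (takeWhile (\<lambda>j. \<not> P j) js)))"

definition search :: "'k \<Rightarrow> ('k, 'v) hashmap \<Rightarrow> nat option" where
  "search x t = find (\<lambda>j. skey (slots t ! j) = Some x) (chain_of t x)"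

definition delete :: "'k \<Rightarrow> ('k, 'v) hashmap \<Rightarrow> ('k, 'v) hashmap" where
  "delete x t =
     (case search x t of
        None \<Rightarrow> t
      | Some i \<Rightarrow> t\<lparr>slots := (slots t)[i := (slots t ! i)\<lparr>sval := None\<rparr>]\<rparr>)"

definition delete_steps :: "'k \<Rightarrow> ('k, 'v) hashmap \<Rightarrow> nat" where
  "delete_steps x t = 1 + probes (\<lambda>j. skey (slots t ! j) = Some x) (chain_of t x)"

definition scan_order :: "('k, 'v) hashmap \<Rightarrow> nat list" where
  "scan_order t = rev [0..<nat (lastfree t + 1)]"

definition find_free :: "('k, 'v) hashmap \<Rightarrow> nat option" where
  "find_free t = find (\<lambda>j. is_free (slots t ! j)) (scan_order t)"

definition predecessor :: "('k, 'v) hashmap \<Rightarrow> 'k \<Rightarrow> nat \<Rightarrow> nat option" where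
  "predecessor t x i = find (\<lambda>j. snext (slots t ! j) = Some i) (chain_of t x)"

definition relink :: "nat option \<Rightarrow> nat \<Rightarrow> ('k, 'v) slot list \<Rightarrow> ('k, 'v) slot list" where
  "relink j f xs =
     (case j of None \<Rightarrow> xs | Some j \<Rightarrow> xs[j := (xs ! j)\<lparr>snext := Some f\<rparr>])"

text \<open>
  Insertion of the new key \<open>x\<close>, whose main position is \<open>i\<close>, without rehash; the result is
  \<open>None\<close> if a free slot is needed but \<open>lastfree\<close> leaves the array.
\<close>

definition place :: "nat \<Rightarrow> 'k \<Rightarrow> 'v \<Rightarrow> ('k, 'v) hashmap \<Rightarrow> ('k, 'v) hashmap option" where
  "place i x y t =
     (let xs = slots t; s = xs ! i in
      if is_free s \<or> is_deleted s
      then Some (t\<lparr>slots := xs[i := s\<lparr>skey := Some x, sval := Some y\<rparr>]\<rparr>)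
      else
        (case find_free t of
           None \<Rightarrow> None
         | Some f \<Rightarrow>
             (let x' = the (skey s) in
              Some (t\<lparr>lastfree := int f,
                      slots :=
                        (if hash t x' = Some i
                         then xs[f := \<lparr>skey = Some x, sval = Some y, snext = snext s\<rparr>,
                                 i := s\<lparr>snext := Some f\<rparr>]
                         else (relink (predecessor t x' i) f xs)
                                [f := s,
                                 i := \<lparr>skey = Some x, sval = Some y, snext = None\<rparr>])\<rparr>))))"

definition place_steps :: "nat \<Rightarrow> ('k, 'v) hashmap \<Rightarrow> nat" where
  "place_steps i t =
     (let s = slots t ! i in
      if is_free s \<or> is_deleted s then 0
      else
        probes (\<lambda>j. is_free (slots t ! j)) (scan_order t) +
        (let x' = the (skey s) in
         if find_free t = None \<or> hash t x' = Some i then 0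
         else probes (\<lambda>j. snext (slots t ! j) = Some i) (chain_of t x')))"

definition main_position :: "'k \<Rightarrow> ('k, 'v) hashmap \<Rightarrow> nat pmf" where
  "main_position x t =
     (case hash t x of
        Some i \<Rightarrow> return_pmf i
      | None \<Rightarrow> pmf_of_set {..<length (slots t)})"

text \<open>
  The body of the insertion function up to the decision whether to rehash, together with
  the number of elementary steps performed.
\<close>

definition try_insert ::
  "'k \<Rightarrow> 'v \<Rightarrow> ('k, 'v) hashmap \<Rightarrow> (('k, 'v) hashmap option \<times> nat) pmf" where
  "try_insert x y t =
     (if slots t = [] then return_pmf (None, 1)
      else do {
        i \<leftarrow> main_position x t;
        let t' = t\<lparr>hash := (hash t)(x \<mapsto> i)\<rparr>;
        return_pmf (place i x y t', 1 + place_steps i t')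
      })"

text \<open>
  A run carries the hashmap, the number of keys inserted by the user so far,
  the number of calls to the insertion function (including those made by rehashes) and the
  running time, counted in elementary steps: one per call of the insertion or deletion function,
  one per slot examined by a search or scan, and, at a rehash, one per slot of the old array
  (counting and traversal) and one per slot of the new array (allocation).
\<close>

record ('k, 'v) run_state =
  hmap :: "('k, 'v) hashmap"
  inserted :: nat
  calls :: nat
  steps :: nat

text \<open>
  The calls to the insertion function made by a rehash. These never need a rehash
  themselves, see \<open>rehash_no_nested_rehash\<close> below, so what is done in the case \<open>None\<close> is irrelevant.
\<close>

fun reinsert :: "('k \<times> 'v) list \<Rightarrow> ('k, 'v) run_state \<Rightarrow> ('k, 'v) run_state pmf" where
  "reinsert [] st = return_pmf st"
| "reinsert ((x, y) # ps) st = do {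
     (r, c) \<leftarrow> try_insert x y (hmap st);
     reinsert ps (st\<lparr>hmap := (case r of None \<Rightarrow> hmap st | Some t \<Rightarrow> t),
                     calls := calls st + 1, steps := steps st + c\<rparr>)
   }"

definition rehash_size :: "('k, 'v) hashmap \<Rightarrow> nat" where
  "rehash_size t = 2 ^ (LEAST m. length (filter is_used (slots t)) + 1 \<le> 2 ^ m)"

definition rehash :: "'k \<Rightarrow> 'v \<Rightarrow> ('k, 'v) run_state \<Rightarrow> ('k, 'v) run_state pmf" where
  "rehash x y st =
     (let t = hmap st; M' = rehash_size t in
      reinsert (used_pairs t @ [(x, y)])
        (st\<lparr>hmap := new_hashmap M', steps := steps st + length (slots t) + M'\<rparr>))"

definition lua_insert :: "'k \<Rightarrow> 'v \<Rightarrow> ('k, 'v) run_state \<Rightarrow> ('k, 'v) run_state pmf" where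
  "lua_insert x y st = do {
     (r, c) \<leftarrow> try_insert x y (hmap st);
     let st' = st\<lparr>calls := calls st + 1, steps := steps st + c\<rparr>;
     (case r of
        Some t \<Rightarrow> return_pmf (st'\<lparr>hmap := t\<rparr>)
      | None \<Rightarrow> rehash x y st')
   }"

text \<open>The invariant satisfied by an array after \<open>c\<close> insertions and no deletion.\<close>

definition filled :: "nat \<Rightarrow> ('k, 'v) hashmap \<Rightarrow> bool" where
  "filled c t \<longleftrightarrow>
     (let n = length (slots t) in
      card {j. j < n \<and> \<not> is_free (slots t ! j)} = c \<and> lastfree t < int n \<and>
      (\<forall>j<n. is_free (slots t ! j) \<or> is_used (slots t ! j)) \<and>
      (\<forall>j<n. lastfree t < int j \<longrightarrow> \<not> is_free (slots t ! j)) \<and>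
      (\<forall>x i. hash t x = Some i \<longrightarrow> i < n))"

lemma find_free_SomeD:
  assumes "find_free t = Some f" "lastfree t < int (length (slots t))"
  shows "f < length (slots t)" "is_free (slots t ! f)" "int f \<le> lastfree t"
    "\<And>j. j < length (slots t) \<Longrightarrow> int f < int j \<Longrightarrow> int j \<le> lastfree t \<Longrightarrow> \<not> is_free (slots t ! j)"
proof -
  let ?L = "nat (lastfree t + 1)"
  from assms(1) obtain i where i: "i < ?L" "is_free (slots t ! f)" "f = rev [0..<?L] ! i"
      "\<forall>j<i. \<not> is_free (slots t ! (rev [0..<?L] ! j))"
    unfolding find_free_def scan_order_def find_Some_iff by auto
  have f: "f = ?L - Suc i" using i by (simp add: rev_nth)
  show "f < length (slots t)" "is_free (slots t ! f)" "int f \<le> lastfree t"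
    using i f assms(2) by auto
  fix j assume j: "j < length (slots t)" "int f < int j" "int j \<le> lastfree t"
  have "?L - Suc j < i" using j f i(1) by linarith
  moreover have "rev [0..<?L] ! (?L - Suc j) = j" using j by (subst rev_nth) auto
  ultimately show "\<not> is_free (slots t ! j)" using i(4) by metis
qed

lemma find_free_NoneD:
  assumes "find_free t = None" "int j \<le> lastfree t"
  shows "\<not> is_free (slots t ! j)"
  using assms unfolding find_free_def scan_order_def find_None_iff by auto

lemma card_occupied_insert:
  assumes "f < length xs" "is_free (xs ! f)" "length ys = length xs"
    "\<And>j. j < length xs \<Longrightarrow> is_free (ys ! j) \<longleftrightarrow> is_free (xs ! j) \<and> j \<noteq> f"
  shows "card {j. j < length ys \<and> \<not> is_free (ys ! j)} =
    Suc (card {j. j < length xs \<and> \<not> is_free (xs ! j)})"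
proof -
  have "{j. j < length ys \<and> \<not> is_free (ys ! j)} =
      insert f {j. j < length xs \<and> \<not> is_free (xs ! j)}"
    using assms by auto
  then show ?thesis using assms(2) by simp
qed

lemma relink_occupancy:
  "length (relink p f xs) = length xs"
  "j < length xs \<Longrightarrow> is_free (relink p f xs ! j) = is_free (xs ! j)"
  "j < length xs \<Longrightarrow> is_used (relink p f xs ! j) = is_used (xs ! j)"
  by (cases "p = Some j"; auto simp: relink_def is_free_def is_used_def split: option.split)+

lemma occupancy_simps:
  "is_free (s\<lparr>snext := n\<rparr>) = is_free s"
  "is_used (s\<lparr>snext := n\<rparr>) = is_used s"
  "\<not> is_free \<lparr>skey = Some x, sval = Some y, snext = n\<rparr>"
  "is_used \<lparr>skey = Some x, sval = Some y, snext = n\<rparr>"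
  "is_used s \<Longrightarrow> \<not> is_free s"
  by (auto simp: is_free_def is_used_def)

lemma filled_place:
  assumes "filled c t" "c < length (slots t)" "i < length (slots t)"
  shows "\<exists>t'. place i x y t = Some t' \<and> filled (Suc c) t' \<and> length (slots t') = length (slots t)"
proof -
  let ?xs = "slots t" and ?n = "length (slots t)"
  let ?s = "?xs ! i"
  have F: "card {j. j < ?n \<and> \<not> is_free (?xs ! j)} = c" "lastfree t < int ?n"
    "\<And>j. j < ?n \<Longrightarrow> is_free (?xs ! j) \<or> is_used (?xs ! j)"
    "\<And>j. j < ?n \<Longrightarrow> lastfree t < int j \<Longrightarrow> \<not> is_free (?xs ! j)"
    "\<And>x i. hash t x = Some i \<Longrightarrow> i < ?n"
    using assms(1) unfolding filled_def Let_def by blast+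
  have key: "filled (Suc c) t'"
    if "f < ?n" "is_free (?xs ! f)" "length (slots t') = ?n"
      and fr: "\<And>j. j < ?n \<Longrightarrow> is_free (slots t' ! j) \<longleftrightarrow> is_free (?xs ! j) \<and> j \<noteq> f"
      and us: "\<And>j. j < ?n \<Longrightarrow> is_used (slots t' ! j) \<longleftrightarrow> is_used (?xs ! j) \<or> j = f"
      and h: "hash t' = hash t"
      and l: "lastfree t' = lastfree t \<or> lastfree t' = int f \<and> find_free t = Some f" for f t'
    unfolding filled_def Let_def that(3)
  proof (intro conjI allI impI)
    show "card {j. j < ?n \<and> \<not> is_free (slots t' ! j)} = Suc c"
      using card_occupied_insert[OF that(1,2,3) fr] F(1) that(3) by simp
    show "lastfree t' < int ?n" using l F(2) that(1) by auto
    show "is_free (slots t' ! j) \<or> is_used (slots t' ! j)" if "j < ?n" for j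
      using fr us F(3) that by blast
    show "\<not> is_free (slots t' ! j)" if "j < ?n" "lastfree t' < int j" for j
      using l fr[OF that(1)] F(4)[OF that(1)] find_free_SomeD(4)[of t f j] F(2) that by fastforce
    show "i < ?n" if "hash t' x = Some i" for x i using F(5) h that by simp
  qed
  show ?thesis
  proof (cases "is_free ?s")
    case True
    show ?thesis
      unfolding place_def Let_def using True assms(3)
      by (auto intro!: key[of i] simp: nth_list_update is_free_def is_used_def split: if_splits)
  next
    case False
    then have u: "is_used ?s" using F(3) assms(3) by blast
    then have nd: "\<not> is_deleted ?s" by (auto simp: is_used_def is_deleted_def)
    have "find_free t \<noteq> None"
    proof
      assume N: "find_free t = None"
      have "{j. j < ?n \<and> \<not> is_free (?xs ! j)} = {..<?n}"
        using find_free_NoneD[OF N] F(4) by (auto) (meson not_le)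
      then show False using F(1) assms(2) by simp
    qed
    then obtain f where f: "find_free t = Some f" by blast
    note ff = find_free_SomeD[OF f F(2)]
    have "f \<noteq> i" using ff False by auto
    show ?thesis
      unfolding place_def Let_def
      using False nd f ff assms(3) \<open>f \<noteq> i\<close> u
      by (cases "hash t (the (skey ?s)) = Some i")
        (auto intro!: key[of f] simp: nth_list_update relink_occupancy occupancy_simps
           split: if_splits)
  qed
qed

lemma filled_try_insert:
  assumes "filled c t" "c < length (slots t)" "(r, d) \<in> set_pmf (try_insert x y t)"
  shows "\<exists>t'. r = Some t' \<and> filled (Suc c) t' \<and> length (slots t') = length (slots t)"
proof -
  have ne: "slots t \<noteq> []" using assms(2) by auto
  obtain i where i: "i \<in> set_pmf (main_position x t)" "r = place i x y (t\<lparr>hash := (hash t)(x \<mapsto> i)\<rparr>)"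
    using assms(3) ne unfolding try_insert_def Let_def by auto
  have il: "i < length (slots t)"
    using i(1) assms(1) ne unfolding main_position_def filled_def Let_def
    by (auto split: option.splits simp: set_pmf_of_set lessThan_empty_iff)
  have "filled c (t\<lparr>hash := (hash t)(x \<mapsto> i)\<rparr>)"
    using assms(1) il unfolding filled_def Let_def by auto
  from filled_place[OF this, of i x y] show ?thesis using assms(2) il i(2) by auto
qed

lemma filled_reinsert:
  assumes "filled c (hmap st)" "c + length ps \<le> length (slots (hmap st))"
    "st' \<in> set_pmf (reinsert ps st)"
  shows "filled (c + length ps) (hmap st') \<and> length (slots (hmap st')) = length (slots (hmap st))"
  using assms
proof (induction ps st arbitrary: c rule: reinsert.induct)
  case (1 st)
  then show ?case by simp
next
  case (2 x y ps st)
  from "2.prems"(3) obtain r d where rd: "(r, d) \<in> set_pmf (try_insert x y (hmap st))"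
    "st' \<in> set_pmf (reinsert ps (st\<lparr>hmap := (case r of None \<Rightarrow> hmap st | Some t \<Rightarrow> t),
                     calls := calls st + 1, steps := steps st + d\<rparr>))"
    by auto
  obtain t' where t': "r = Some t'" "filled (Suc c) t'"
      "length (slots t') = length (slots (hmap st))"
    using filled_try_insert[OF "2.prems"(1) _ rd(1)] "2.prems"(2) by auto
  show ?case
    using "2.IH"[OF rd(1) refl, of "Suc c"] rd(2) t' "2.prems"(2) by simp
qed

lemma rehash_no_nested_rehash:
  assumes "hmap st = new_hashmap (rehash_size t)"
    and "used_pairs t @ [(x, y)] = ps @ (x', y') # qs"
    and "st' \<in> set_pmf (reinsert ps st)"
    and "(r, c) \<in> set_pmf (try_insert x' y' (hmap st'))"
  shows "r \<noteq> None"
proof -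
  let ?u = "length (filter is_used (slots t))"
  have size: "?u + 1 \<le> rehash_size t"
    unfolding rehash_size_def
    by (rule LeastI[of "\<lambda>m. ?u + 1 \<le> 2 ^ m" ?u]) (metis Suc_eq_plus1 Suc_leI less_exp)
  have len: "length ps < rehash_size t"
    using size arg_cong[OF assms(2), of length] unfolding used_pairs_def by simp
  have "filled 0 (hmap st)"
    unfolding assms(1) filled_def new_hashmap_def by (auto simp: is_free_def)
  moreover have "length (slots (hmap st)) = rehash_size t"
    unfolding assms(1) new_hashmap_def by simp
  ultimately have "filled (length ps) (hmap st')" "length (slots (hmap st')) = rehash_size t"
    using filled_reinsert[of 0 st ps st'] assms(3) len by auto
  from filled_try_insert[OF this(1) _ assms(4)] this(2) len show ?thesis by auto
qed

text \<open>The \<open>n\<close>-th insertion (counted from 0) inserts the new key \<open>key n\<close> with value \<open>val n\<close>.\<close>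

definition random_insert ::
  "(nat \<Rightarrow> 'k) \<Rightarrow> (nat \<Rightarrow> 'v) \<Rightarrow> ('k, 'v) run_state \<Rightarrow> ('k, 'v) run_state pmf" where
  "random_insert key val st =
     lua_insert (key (inserted st)) (val (inserted st)) (st\<lparr>inserted := inserted st + 1\<rparr>)"

definition random_delete :: "('k, 'v) run_state \<Rightarrow> ('k, 'v) run_state pmf" where
  "random_delete st = do {
     x \<leftarrow> pmf_of_set (used_keys (hmap st));
     return_pmf (st\<lparr>hmap := delete x (hmap st), steps := steps st + delete_steps x (hmap st)\<rparr>)
   }"

definition random_operation ::
  "(nat \<Rightarrow> 'k) \<Rightarrow> (nat \<Rightarrow> 'v) \<Rightarrow> real \<Rightarrow> ('k, 'v) run_state \<Rightarrow> ('k, 'v) run_state pmf" where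
  "random_operation key val p st = do {
     b \<leftarrow> (if used_keys (hmap st) = {} then return_pmf True else bernoulli_pmf p);
     if b then random_insert key val st else random_delete st
   }"

fun run :: "(nat \<Rightarrow> 'k) \<Rightarrow> (nat \<Rightarrow> 'v) \<Rightarrow> real \<Rightarrow> nat \<Rightarrow> ('k, 'v) run_state pmf" where
  "run key val p 0 =
     return_pmf \<lparr>hmap = empty_hashmap, inserted = 0, calls = 0, steps = 0\<rparr>"
| "run key val p (Suc T) = run key val p T \<bind> random_operation key val p"

definition superpoly_high_prob :: "(nat \<Rightarrow> 'a pmf) \<Rightarrow> (nat \<Rightarrow> 'a \<Rightarrow> bool) \<Rightarrow> bool" where
  "superpoly_high_prob X P \<longleftrightarrow>
     (\<exists>c>0. eventually (\<lambda>T. measure_pmf.prob (X T) {w. \<not> P T w} \<le> exp (- (real T powr c)))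
              sequentially)"

end

theory Submission
  imports Defs "HOL-Real_Asymp.Real_Asymp"
begin

text \<open>
  While the array has \<open>M\<close> slots, call \<open>g = M - #used\<close> the gap. An insertion that does not hit a
  deleted slot consumes a free slot for good, and there are at most \<open>g\<close> free slots; so once \<open>g\<close> is a
  small fraction of \<open>M\<close>, about \<open>g / p\<close> operations exhaust them and force a rehash. In that time the
  gap shrinks only by about \<open>(2 p - 1) g / p\<close>, hence by a constant factor below \<open>1\<close>, except with
  probability exponentially small in \<open>g\<close>. Starting from a gap of order \<open>sqrt M\<close>, with \<open>M\<close> of order \<open>T\<close>,
  there are therefore \<open>\<Omega>(log T)\<close> rehashes at this size, each reinserting at least \<open>M / 2\<close> keys.
  The number of used keys only follows this random walk because deletions find their key, which
  needs the chain invariant of the hashmap.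
\<close>

section \<open>Chains\<close>

text \<open>Phases have a length fixed in advance, proportional to the gap at their start, instead
  of ending at a rehash. They can then be glued by the Markov property without stopping times, and a
  phase only has to contain at least one rehash. Over one phase the gap grows by at most a factor
  \<open>2 ^ b\<close>, by mere counting, and shrinks by at most a factor \<open>2 ^ r\<close>, with
  high probability. Two requirements pull the gap in opposite directions. It must stay a small
  fraction of \<open>M\<close>, so that new keys rarely land on deleted slots and every rehash again
  chooses \<open>M\<close> slots. It must also stay above a power of \<open>M\<close>, so that
  errors of the form \<open>exp (- c * g)\<close> are super-polynomially small. A starting gap of
  order sqrt M leaves room on both sides for a number of phases proportional to log M. Deletions are
  estimated for every possible choice of the key. The randomness of the hash values enters through
  the chance that a new key hits a deleted slot, which is at most the ratio of gap to
  \<open>M\<close>.\<close>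

definition links :: "('k, 'v) slot list \<Rightarrow> (nat \<times> nat) set" where
  "links xs = {(a, b). a < length xs \<and> snext (xs ! a) = Some b}"

text \<open>That the main position of every stored key holds a key at \<^emph>\<open>its\<close> main position guarantees that
  no key hashes to a slot whose key gets displaced, so a displacement does not cut any chain.\<close>

definition stored :: "('k, 'v) slot list \<Rightarrow> ('k \<rightharpoonup> nat) \<Rightarrow> nat \<Rightarrow> 'k \<Rightarrow> bool" where
  "stored xs H j x \<longleftrightarrow> (\<exists>h. H x = Some h \<and> h < length xs \<and> (h, j) \<in> (links xs)\<^sup>* \<and>
     (\<exists>w. skey (xs ! h) = Some w \<and> H w = Some h))"

text \<open>The last clause makes the slot found by the predecessor search the only one whose link
  must change in a displacement. Cycles are not excluded by these clauses;
  \<open>chain_reaches\<close> bounds the walk by counting links instead.\<close>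

definition chains_ok :: "('k, 'v) slot list \<Rightarrow> ('k \<rightharpoonup> nat) \<Rightarrow> bool" where
  "chains_ok xs H \<longleftrightarrow>
     (\<forall>j<length xs. skey (xs ! j) = None \<longrightarrow> sval (xs ! j) = None \<and> snext (xs ! j) = None) \<and>
     (\<forall>j<length xs. \<forall>x. skey (xs ! j) = Some x \<longrightarrow> stored xs H j x) \<and>
     (\<forall>i<length xs. \<forall>j<length xs. \<forall>x. skey (xs ! i) = Some x \<longrightarrow> skey (xs ! j) = Some x \<longrightarrow> i = j) \<and>
     (\<forall>a b. (a, b) \<in> links xs \<longrightarrow> b < length xs \<and> skey (xs ! b) \<noteq> None) \<and>
     (\<forall>a a' b. (a, b) \<in> links xs \<longrightarrow> (a', b) \<in> links xs \<longrightarrow> a = a')"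

section \<open>The chain invariant under updates of the array\<close>

lemma nth_update_valid: "j < length xs \<Longrightarrow> xs[i := a] ! j = (if i = j then a else xs ! j)"
  by (cases "i = j") auto

lemma chains_okD:
  assumes "chains_ok xs H"
  shows "\<And>j. j < length xs \<Longrightarrow> skey (xs ! j) = None \<Longrightarrow> sval (xs ! j) = None"
    "\<And>j. j < length xs \<Longrightarrow> skey (xs ! j) = None \<Longrightarrow> snext (xs ! j) = None"
    "\<And>j x. j < length xs \<Longrightarrow> skey (xs ! j) = Some x \<Longrightarrow> stored xs H j x"
    "\<And>i j x. i < length xs \<Longrightarrow> j < length xs \<Longrightarrow> skey (xs ! i) = Some x \<Longrightarrow> skey (xs ! j) = Some x \<Longrightarrow> i = j"
    "\<And>a b. (a, b) \<in> links xs \<Longrightarrow> b < length xs"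
    "\<And>a b. (a, b) \<in> links xs \<Longrightarrow> skey (xs ! b) \<noteq> None"
    "\<And>a a' b. (a, b) \<in> links xs \<Longrightarrow> (a', b) \<in> links xs \<Longrightarrow> a = a'"
  using assms unfolding chains_ok_def by simp_all

lemma chains_okI:
  assumes "\<And>j. j < length xs \<Longrightarrow> skey (xs ! j) = None \<Longrightarrow> sval (xs ! j) = None \<and> snext (xs ! j) = None"
    "\<And>j x. j < length xs \<Longrightarrow> skey (xs ! j) = Some x \<Longrightarrow> stored xs H j x"
    "\<And>i j x. i < length xs \<Longrightarrow> j < length xs \<Longrightarrow> skey (xs ! i) = Some x \<Longrightarrow> skey (xs ! j) = Some x \<Longrightarrow> i = j"
    "\<And>a b. (a, b) \<in> links xs \<Longrightarrow> b < length xs \<and> skey (xs ! b) \<noteq> None"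
    "\<And>a a' b. (a, b) \<in> links xs \<Longrightarrow> (a', b) \<in> links xs \<Longrightarrow> a = a'"
  shows "chains_ok xs H"
  unfolding chains_ok_def by (intro conjI allI impI) (fact | rule assms(1)[THEN conjunct1] assms(1)[THEN conjunct2] assms(4)[THEN conjunct1] assms(4)[THEN conjunct2], assumption+ | rule assms, assumption+)+

text \<open>The links stay as they are. The overwritten key may have been the one that
  \<open>stored\<close> demands at \<open>i\<close> for other keys hashing there; \<open>x\<close>,
  being at its main position, takes over that duty.\<close>

lemma chains_ok_set_main:
  assumes ok: "chains_ok xs H" and i: "i < length xs" and H: "H x = Some i"
    and fresh: "\<And>j. j < length xs \<Longrightarrow> skey (xs ! j) \<noteq> Some x"
  shows "chains_ok (xs[i := (xs ! i)\<lparr>skey := Some x, sval := v\<rparr>]) H" (is "chains_ok ?ys H")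
proof -
  note D = chains_okD[OF ok]
  have L: "links ?ys = links xs"
    by (auto simp: links_def nth_update_valid split: if_splits)
  have K: "skey (?ys ! j) = (if j = i then Some x else skey (xs ! j))" if "j < length xs" for j
    using that i by (simp add: nth_update_valid)
  show ?thesis
  proof (rule chains_okI)
    fix j assume "j < length ?ys" "skey (?ys ! j) = None"
    then show "sval (?ys ! j) = None \<and> snext (?ys ! j) = None"
      using D(1,2)[of j] K[of j] by (auto simp: nth_update_valid split: if_splits)
  next
    fix j z assume j: "j < length ?ys" "skey (?ys ! j) = Some z"
    show "stored ?ys H j z"
    proof (cases "j = i")
      case True
      then have "z = x" using j K i by auto
      then show ?thesis using True i H K[OF i] by (auto simp: stored_def)
    next
      case False
      then have "stored xs H j z" using j K D(3) by auto
      then obtain h w where h: "H z = Some h" "h < length xs" "(h, j) \<in> (links xs)\<^sup>*"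
        "skey (xs ! h) = Some w" "H w = Some h" by (auto simp: stored_def)
      have "\<exists>w. skey (?ys ! h) = Some w \<and> H w = Some h" using h K H by auto
      then show ?thesis unfolding stored_def L using h by auto
    qed
  next
    fix a b z assume "a < length ?ys" "b < length ?ys" "skey (?ys ! a) = Some z" "skey (?ys ! b) = Some z"
    then show "a = b" using K fresh D(4) by (auto split: if_splits)
  next
    fix a b assume "(a, b) \<in> links ?ys"
    then show "b < length ?ys \<and> skey (?ys ! b) \<noteq> None" unfolding L using D(5,6)[of a b] K by auto
  next
    fix a a' b assume "(a, b) \<in> links ?ys" "(a', b) \<in> links ?ys"
    then show "a = a'" unfolding L using D(7) by blast
  qed
qed

text \<open>The link leaving \<open>i\<close>, if any, becomes a path of length two through
  \<open>f\<close>. As \<open>f\<close> held no key, no link entered or left it, so every old path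
  survives.\<close>

lemma chains_ok_link_second:
  assumes ok: "chains_ok xs H" and i: "i < length xs" and H: "H x = Some i"
    and fresh: "\<And>j. j < length xs \<Longrightarrow> skey (xs ! j) \<noteq> Some x"
    and f: "f < length xs" "skey (xs ! f) = None"
    and w: "skey (xs ! i) = Some w" "H w = Some i"
  shows "chains_ok (xs[f := \<lparr>skey = Some x, sval = v, snext = snext (xs ! i)\<rparr>,
    i := (xs ! i)\<lparr>snext := Some f\<rparr>]) H" (is "chains_ok ?ys H")
proof -
  note D = chains_okD[OF ok]
  have fi: "f \<noteq> i" using f w by auto
  have K: "skey (?ys ! j) = (if j = f then Some x else skey (xs ! j))" if "j < length xs" for j
    using that i f fi by (simp add: nth_update_valid)
  have N: "snext (?ys ! j) = (if j = f then snext (xs ! i) else if j = i then Some f else snext (xs ! j))"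
    if "j < length xs" for j
    using that i f fi by (simp add: nth_update_valid)
  have nf: "(a, f) \<notin> links xs" for a using D(6) f by blast
  have L: "(a, b) \<in> links ?ys \<longleftrightarrow> (a = i \<and> b = f) \<or> (a = f \<and> (i, b) \<in> links xs) \<or> (a \<noteq> i \<and> a \<noteq> f \<and> (a, b) \<in> links xs)"
    for a b using N[of a] i f fi by (cases "a = f"; cases "a = i") (auto simp: links_def)
  have step: "(a, b) \<in> (links ?ys)\<^sup>*" if "(a, b) \<in> links xs" for a b
  proof (cases "a = i")
    case True
    then have "(i, f) \<in> links ?ys" "(f, b) \<in> links ?ys" using that L by auto
    then show ?thesis using True by auto
  next
    case False
    have "a \<noteq> f" using that D(2) f by (auto simp: links_def)
    then show ?thesis using False that L by auto
  qed
  have sub: "(links xs)\<^sup>* \<subseteq> (links ?ys)\<^sup>*"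
    using step by (intro rtrancl_subset_rtrancl) auto
  show ?thesis
  proof (rule chains_okI)
    fix j assume j: "j < length ?ys" "skey (?ys ! j) = None"
    then have "j \<noteq> f" "skey (xs ! j) = None" "j \<noteq> i" using K w by (auto split: if_splits)
    then show "sval (?ys ! j) = None \<and> snext (?ys ! j) = None"
      using D(1,2)[of j] j by auto
  next
    fix j z assume j: "j < length ?ys" "skey (?ys ! j) = Some z"
    show "stored ?ys H j z"
    proof (cases "j = f")
      case True
      then have "z = x" using j K by auto
      moreover have "(i, f) \<in> (links ?ys)\<^sup>*" using L by auto
      ultimately show ?thesis unfolding stored_def using True i H K[OF i] w fi by auto
    next
      case False
      then have "stored xs H j z" using j K D(3) by auto
      then obtain h u where h: "H z = Some h" "h < length xs" "(h, j) \<in> (links xs)\<^sup>*"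
        "skey (xs ! h) = Some u" "H u = Some h" by (auto simp: stored_def)
      have "h \<noteq> f" using h f by auto
      then have "skey (?ys ! h) = Some u" using h K by auto
      then show ?thesis unfolding stored_def using h sub by auto
    qed
  next
    fix a b z assume "a < length ?ys" "b < length ?ys" "skey (?ys ! a) = Some z" "skey (?ys ! b) = Some z"
    then show "a = b" using K fresh D(4) by (auto split: if_splits)
  next
    fix a b assume "(a, b) \<in> links ?ys"
    then show "b < length ?ys \<and> skey (?ys ! b) \<noteq> None"
      unfolding L using D(5,6) K f by (auto split: if_splits)
  next
    fix a a' b assume "(a, b) \<in> links ?ys" "(a', b) \<in> links ?ys"
    then show "a = a'" unfolding L using D(7) nf by blast
  qed
qed

text \<open>Renaming \<open>i\<close> to \<open>f\<close> maps every old link to a new one. The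
  renaming fixes the main position of every stored key: such a position holds a key that belongs
  there, whereas \<open>w\<close> does not belong at \<open>i\<close>. The chain of \<open>x\<close>
  then starts afresh at \<open>i\<close>.\<close>

lemma chains_ok_move:
  assumes ok: "chains_ok xs H" and i: "i < length xs" and H: "H x = Some i"
    and fresh: "\<And>j. j < length xs \<Longrightarrow> skey (xs ! j) \<noteq> Some x"
    and f: "f < length xs" "skey (xs ! f) = None"
    and w: "skey (xs ! i) = Some w" "H w \<noteq> Some i"
    and p: "(p, i) \<in> links xs" "p \<noteq> i"
  shows "chains_ok ((xs[p := (xs ! p)\<lparr>snext := Some f\<rparr>])[f := xs ! i,
    i := \<lparr>skey = Some x, sval = v, snext = None\<rparr>]) H" (is "chains_ok ?ys H")
proof -
  note D = chains_okD[OF ok]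
  have fi: "f \<noteq> i" using f w by auto
  have pf: "p \<noteq> f" using p D(2) f by (auto simp: links_def)
  have pl: "p < length xs" using p by (auto simp: links_def)
  have K: "skey (?ys ! j) = (if j = f then Some w else if j = i then Some x else skey (xs ! j))" if "j < length xs" for j
    using that i f fi w by (simp add: nth_update_valid)
  have N: "snext (?ys ! j) = (if j = f then snext (xs ! i) else if j = i then None else
      if j = p then Some f else snext (xs ! j))"
    if "j < length xs" for j
    using that i f fi pf p by (simp add: nth_update_valid)
  have nf: "(a, f) \<notin> links xs" for a using D(6) f by blast
  have ni: "(a, i) \<in> links xs \<Longrightarrow> a = p" for a using D(7) p by blast
  have pp: "(p, b) \<in> links xs \<Longrightarrow> b = i" for b using p by (auto simp: links_def)
  have L: "(a, b) \<in> links ?ys \<longleftrightarrow> (a = p \<and> b = f) \<or> (a = f \<and> (i, b) \<in> links xs) \<or>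
      (a \<noteq> i \<and> a \<noteq> f \<and> a \<noteq> p \<and> (a, b) \<in> links xs)"
    for a b using N[of a] i f fi pf p pl by (cases "a = f"; cases "a = i"; cases "a = p") (auto simp: links_def)
  define \<sigma> where "\<sigma> a = (if a = i then f else a)" for a :: nat
  have step: "(\<sigma> a, \<sigma> b) \<in> links ?ys" if "(a, b) \<in> links xs" for a b
  proof -
    have "a \<noteq> f" using that D(2) f by (auto simp: links_def)
    moreover have "b = i \<longleftrightarrow> a = p" using that ni[of a] pp[of b] by blast
    ultimately show ?thesis using that p(2) unfolding L \<sigma>_def
      by (cases "a = p"; cases "a = i") simp_all
  qed
  have reach: "(\<sigma> a, \<sigma> b) \<in> (links ?ys)\<^sup>*" if "(a, b) \<in> (links xs)\<^sup>*" for a b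
    using that by (induction rule: rtrancl_induct) (auto intro: rtrancl.rtrancl_into_rtrancl step)
  have other: "stored ?ys H (\<sigma> j) z" if j: "j < length xs" "skey (xs ! j) = Some z" for j z
  proof -
    obtain h u where h: "H z = Some h" "h < length xs" "(h, j) \<in> (links xs)\<^sup>*"
        "skey (xs ! h) = Some u" "H u = Some h" using D(3)[OF j] unfolding stored_def by blast
    have "h \<noteq> f" "h \<noteq> i" using h f w by auto
    then have "skey (?ys ! h) = Some u" "(h, \<sigma> j) \<in> (links ?ys)\<^sup>*"
      using K[OF h(2)] h(4) reach[OF h(3)] unfolding \<sigma>_def by (simp_all only: if_False)
    then show ?thesis unfolding stored_def using h by auto
  qed
  show ?thesis
  proof (rule chains_okI)
    fix j assume j: "j < length ?ys" "skey (?ys ! j) = None"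
    then have "j \<noteq> f" "skey (xs ! j) = None" "j \<noteq> i" using K w by (auto split: if_splits)
    moreover then have "j \<noteq> p" using p D(2) by (auto simp: links_def)
    ultimately show "sval (?ys ! j) = None \<and> snext (?ys ! j) = None"
      using D(1,2)[of j] j by auto
  next
    fix j z assume j: "j < length ?ys" "skey (?ys ! j) = Some z"
    consider "j = f" | "j = i" | "j \<noteq> f" "j \<noteq> i" by blast
    then show "stored ?ys H j z"
    proof cases
      case 1
      then show ?thesis using other[OF i w(1)] j K[of f] f by (auto simp: \<sigma>_def)
    next
      case 2
      then have "z = x" using j K fi by auto
      then show ?thesis unfolding stored_def using 2 i H K[OF i] fi by auto
    next
      case 3
      then show ?thesis using other[of j z] j K[of j] by (auto simp: \<sigma>_def)
    qed
  next
    fix a b z assume "a < length ?ys" "b < length ?ys" "skey (?ys ! a) = Some z" "skey (?ys ! b) = Some z"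
    then show "a = b" using K fresh D(4) i w fi by (auto split: if_splits)
  next
    fix a b assume "(a, b) \<in> links ?ys"
    then show "b < length ?ys \<and> skey (?ys ! b) \<noteq> None"
      unfolding L using D(5,6) K f by (auto split: if_splits)
  next
    fix a a' b assume "(a, b) \<in> links ?ys" "(a', b) \<in> links ?ys"
    then show "a = a'" unfolding L using D(7) nf ni p by blast
  qed
qed

lemma chains_ok_clear_value:
  assumes ok: "chains_ok xs H"
  shows "chains_ok (xs[i := (xs ! i)\<lparr>sval := None\<rparr>]) H" (is "chains_ok ?ys H")
proof -
  note D = chains_okD[OF ok]
  have K: "skey (?ys ! j) = skey (xs ! j)" and N: "snext (?ys ! j) = snext (xs ! j)"
    and V: "sval (?ys ! j) = None \<or> sval (?ys ! j) = sval (xs ! j)"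
    if "j < length xs" for j
    using that by (auto simp: nth_update_valid)
  have L: "links ?ys = links xs" using N by (auto simp: links_def)
  have S: "stored ?ys H j x \<longleftrightarrow> stored xs H j x" for j x
    unfolding stored_def L using K by auto
  show ?thesis
  proof (rule chains_okI)
    fix j assume "j < length ?ys" "skey (?ys ! j) = None"
    then show "sval (?ys ! j) = None \<and> snext (?ys ! j) = None"
      using D(1,2)[of j] K[of j] N[of j] V[of j] by auto
  next
    fix j z assume "j < length ?ys" "skey (?ys ! j) = Some z"
    then show "stored ?ys H j z" unfolding S using D(3) K by auto
  next
    fix a b z assume "a < length ?ys" "b < length ?ys" "skey (?ys ! a) = Some z" "skey (?ys ! b) = Some z"
    then show "a = b" using K[of a] K[of b] D(4)[of a b z] by auto
  next
    fix a b assume "(a, b) \<in> links ?ys"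
    then show "b < length ?ys \<and> skey (?ys ! b) \<noteq> None" unfolding L using D(5,6)[of a b] K[of b] by auto
  next
    fix a a' b assume "(a, b) \<in> links ?ys" "(a', b) \<in> links ?ys"
    then show "a = a'" unfolding L using D(7) by blast
  qed
qed

section \<open>Following links: search and predecessor\<close>

lemma chain_relpow:
  assumes "(h, i) \<in> links xs ^^ k" "k < b"
  shows "i \<in> set (chain xs b (Some h))"
  using assms
proof (induction k arbitrary: h b)
  case 0
  then show ?case by (cases b) auto
next
  case (Suc k)
  then obtain h' where h': "(h, h') \<in> links xs" "(h', i) \<in> links xs ^^ k"
    by (meson relpow_Suc_D2)
  then have "i \<in> set (chain xs (b - 1) (Some h'))" using Suc by auto
  moreover have "snext (xs ! h) = Some h'" using h' by (auto simp: links_def)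
  ultimately show ?case using Suc.prems by (cases b) auto
qed

lemma chain_reaches:
  assumes "(h, i) \<in> (links xs)\<^sup>*" "i < length xs"
  shows "i \<in> set (chain xs (length xs) (Some h))"
    and "h \<noteq> i \<Longrightarrow> \<exists>a \<in> set (chain xs (length xs) (Some h)). a \<noteq> i \<and> (a, i) \<in> links xs"
proof -
  text \<open>Dropping the link that leaves \<open>i\<close> leaves fewer links than slots, so the walk is short enough.\<close>
  define R where "R = {(a, b). (a, b) \<in> links xs \<and> a \<noteq> i}"
  have img: "R \<subseteq> (\<lambda>a. (a, the (snext (xs ! a)))) ` ({..<length xs} - {i})"
    unfolding R_def links_def by (auto simp: image_iff)
  have fin: "finite R" by (rule finite_subset[OF img]) auto
  have "card R \<le> card ({..<length xs} - {i})"
    by (rule surj_card_le[OF _ img]) auto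
  also have "\<dots> < card {..<length xs}"
    by (rule card_Diff1_less) (simp_all add: assms(2))
  finally have card: "card R < length xs" by simp
  have short: "a \<in> set (chain xs (length xs) (Some h))" if ha: "(h, a) \<in> R\<^sup>*" for a
  proof -
    obtain k where "(h, a) \<in> R ^^ k" using ha rtrancl_power by blast
    then obtain k where k: "(h, a) \<in> R ^^ k" "k \<le> card R"
      using subsetD[OF relpow_finite_bounded[OF fin]] by (smt (verit) UN_E mem_Collect_eq)
    have "(h, a) \<in> links xs ^^ k"
      using k(1) unfolding relpow_fun_conv R_def by blast
    from chain_relpow[OF this] k(2) card show ?thesis by simp
  qed
  have R: "(h, i) \<in> R\<^sup>*"
    using assms(1)
  proof (induction rule: converse_rtrancl_induct)
    case base
    then show ?case by simp
  next
    case (step y z)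
    then show ?case by (cases "y = i") (auto simp: R_def intro: converse_rtrancl_into_rtrancl)
  qed
  show "i \<in> set (chain xs (length xs) (Some h))" using short[OF R] .
  assume "h \<noteq> i"
  then obtain a where "(h, a) \<in> R\<^sup>*" "(a, i) \<in> R" using R by (meson rtranclE)
  then show "\<exists>a \<in> set (chain xs (length xs) (Some h)). a \<noteq> i \<and> (a, i) \<in> links xs"
    using short[of a] unfolding R_def by blast
qed

lemma chain_bounds:
  assumes "chains_ok xs H" "h < length xs" "j \<in> set (chain xs b (Some h))"
  shows "j < length xs"
  using assms(2,3)
proof (induction b arbitrary: h)
  case (Suc b)
  show ?case
  proof (cases "snext (xs ! h)")
    case (Some h')
    then have "h' < length xs" using chains_okD(5)[OF assms(1), of h h'] Suc by (auto simp: links_def)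
    then show ?thesis using Suc Some by auto
  qed (use Suc in auto)
qed auto

lemma find_SomeD:
  assumes "find P xs = Some a"
  shows "a \<in> set xs" "P a"
  using assms by (auto simp: find_Some_iff)

lemma find_is_Some:
  assumes "a \<in> set xs" "P a"
  obtains b where "find P xs = Some b" "b \<in> set xs" "P b"
  using assms find_SomeD[of P xs] by (cases "find P xs") (auto simp: find_None_iff)

lemma search_stored:
  assumes ok: "chains_ok (slots t) (hash t)" and j: "j < length (slots t)" "skey (slots t ! j) = Some x"
  shows "search x t = Some j"
proof -
  note D = chains_okD[OF ok]
  obtain h where h: "hash t x = Some h" "h < length (slots t)" "(h, j) \<in> (links (slots t))\<^sup>*"
    using D(3)[OF j] unfolding stored_def by blast
  have "j \<in> set (chain_of t x)" unfolding chain_of_def h(1)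
    by (rule chain_reaches) (use h j in auto)
  then obtain b where b: "search x t = Some b" "b \<in> set (chain_of t x)" "skey (slots t ! b) = Some x"
    unfolding search_def using j(2)
    by (rule find_is_Some[of j "chain_of t x" "\<lambda>j. skey (slots t ! j) = Some x"]) blast
  then have "b < length (slots t)" using chain_bounds[OF ok h(2)] h(1) by (auto simp: chain_of_def)
  from D(4)[OF this j(1) b(3) j(2)] b(1) show ?thesis by simp
qed

text \<open>The displaced key is away from its main position, so its chain enters \<open>i\<close>
  from some other slot. Predecessors are unique, so the search can only return that slot, never
  \<open>i\<close> itself.\<close>

lemma predecessor_stored:
  assumes ok: "chains_ok (slots t) (hash t)" and i: "i < length (slots t)"
    and w: "skey (slots t ! i) = Some w" "hash t w \<noteq> Some i"
  obtains p where "predecessor t w i = Some p" "(p, i) \<in> links (slots t)" "p \<noteq> i"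
proof -
  note D = chains_okD[OF ok]
  obtain h where h: "hash t w = Some h" "h < length (slots t)" "(h, i) \<in> (links (slots t))\<^sup>*"
    using D(3)[OF i w(1)] unfolding stored_def by blast
  have "h \<noteq> i" using h w by auto
  then obtain a where a: "a \<in> set (chain_of t w)" "a \<noteq> i" "(a, i) \<in> links (slots t)"
    using chain_reaches(2)[OF h(3) i] h(1) by (auto simp: chain_of_def)
  then obtain b where b: "predecessor t w i = Some b" "b \<in> set (chain_of t w)" "snext (slots t ! b) = Some i"
    unfolding predecessor_def
    using a(1) a(3)[unfolded links_def]
    by (elim find_is_Some[of a "chain_of t w" "\<lambda>j. snext (slots t ! j) = Some i"]) blast+
  then have "b < length (slots t)" using chain_bounds[OF ok h(2)] h(1) by (auto simp: chain_of_def)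
  then have "(b, i) \<in> links (slots t)" using b by (auto simp: links_def)
  moreover from D(7)[OF this a(3)] a(2) have "b \<noteq> i" by simp
  ultimately show ?thesis using that b(1) by blast
qed

section \<open>Occupancy of the hashmap\<close>

definition wf_hashmap :: "('k, 'v) hashmap \<Rightarrow> bool" where
  "wf_hashmap t \<longleftrightarrow> chains_ok (slots t) (hash t) \<and> lastfree t < int (length (slots t)) \<and>
     (\<forall>j<length (slots t). lastfree t < int j \<longrightarrow> \<not> is_free (slots t ! j))"

definition nused :: "('k, 'v) hashmap \<Rightarrow> nat" where
  "nused t = length (filter is_used (slots t))"

definition nfree :: "('k, 'v) hashmap \<Rightarrow> nat" where
  "nfree t = length (filter is_free (slots t))"

lemma chains_ok_is_free:
  assumes "chains_ok (slots t) (hash t)" "j < length (slots t)"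
  shows "is_free (slots t ! j) \<longleftrightarrow> skey (slots t ! j) = None"
  using chains_okD(1)[OF assms] by (auto simp: is_free_def)

lemma length_filter_update:
  assumes "i < length xs"
  shows "length (filter P (xs[i := a])) + (if P (xs ! i) then 1 else 0) =
    length (filter P xs) + (if P a then 1 else 0)"
  using assms
proof (induction xs arbitrary: i)
  case (Cons b xs)
  then show ?case by (cases i) auto
qed auto

lemma filter_length_disjoint:
  assumes "\<And>x. x \<in> set xs \<Longrightarrow> P x \<Longrightarrow> \<not> Q x"
  shows "length (filter P xs) + length (filter Q xs) \<le> length xs"
  using assms by (induction xs) auto

lemma nused_nfree_le: "nused t + nfree t \<le> length (slots t)"
  unfolding nused_def nfree_def by (rule filter_length_disjoint) (auto simp: is_used_def is_free_def)

lemma nfree_nonfree: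
  assumes "nfree t = 0" "j < length (slots t)"
  shows "\<not> is_free (slots t ! j)"
  using assms by (auto simp: nfree_def filter_empty_conv)

text \<open>The scan sees only slots up to \<open>lastfree\<close>; since no free slot lies above, a
  failed scan means that none is left at all. Deleted slots are not counted, so a rehash can be
  forced while the array still holds some.\<close>

lemma find_free_None_iff:
  assumes "wf_hashmap t"
  shows "find_free t = None \<longleftrightarrow> nfree t = 0"
proof
  assume "find_free t = None"
  then have "\<not> is_free (slots t ! j)" if "j < length (slots t)" for j
    using find_free_NoneD[of t j] assms that unfolding wf_hashmap_def by (metis not_le)
  then show "nfree t = 0" by (auto simp: nfree_def filter_empty_conv in_set_conv_nth)
next
  assume *: "nfree t = 0"
  show "find_free t = None"
  proof (rule ccontr)
    assume "find_free t \<noteq> None"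
    then obtain f where "find_free t = Some f" by auto
    then show False
      using find_free_SomeD(1,2)[of t f] nfree_nonfree[OF *] assms unfolding wf_hashmap_def by blast
  qed
qed

text \<open>Only a key that hashes onto a deleted slot spares the free slots. This dichotomy is what
  the probabilistic part retains of the array layout.\<close>

lemma place_cases:
  assumes "wf_hashmap t" "i < length (slots t)" "hash t x = Some i"
    and fresh: "\<And>j. j < length (slots t) \<Longrightarrow> skey (slots t ! j) \<noteq> Some x"
  shows "(place i x y t = None \<longrightarrow> nfree t = 0 \<and> is_used (slots t ! i)) \<and>
    (\<forall>t'. place i x y t = Some t' \<longrightarrow> wf_hashmap t' \<and> length (slots t') = length (slots t) \<and>
      hash t' = hash t \<and> nused t' = Suc (nused t) \<and>
      (if is_deleted (slots t ! i) then nfree t' = nfree t else Suc (nfree t') = nfree t))"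
proof -
  let ?xs = "slots t" and ?s = "slots t ! i"
  have ok: "chains_ok ?xs (hash t)" and lf: "lastfree t < int (length ?xs)"
    and nf: "\<And>j. j < length ?xs \<Longrightarrow> lastfree t < int j \<Longrightarrow> \<not> is_free (?xs ! j)"
    using assms(1) unfolding wf_hashmap_def by auto
  note D = chains_okD[OF ok]
  note i = assms(2)
  show ?thesis
  proof (cases "is_free ?s \<or> is_deleted ?s")
    case True
    define s' where "s' = ?s\<lparr>skey := Some x, sval := Some y\<rparr>"
    have pl: "place i x y t = Some (t\<lparr>slots := ?xs[i := s']\<rparr>)"
      using True by (simp add: place_def Let_def s'_def)
    have s': "is_used s'" "\<not> is_free s'" by (auto simp: s'_def is_used_def is_free_def)
    have ns: "\<not> is_used ?s" using True by (auto simp: is_used_def is_free_def is_deleted_def)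
    have "chains_ok (?xs[i := s']) (hash t)"
      unfolding s'_def by (rule chains_ok_set_main[OF ok i assms(3) fresh])
    moreover have "\<not> is_free (?xs[i := s'] ! j)" if "j < length ?xs" "lastfree t < int j" for j
      using nf[OF that] s'(2) that by (simp add: nth_update_valid)
    ultimately have "wf_hashmap (t\<lparr>slots := ?xs[i := s']\<rparr>)"
      using lf by (simp add: wf_hashmap_def)
    then show ?thesis
      using pl length_filter_update[OF i, of is_used s'] length_filter_update[OF i, of is_free s'] s' ns True
      by (auto simp: nused_def nfree_def is_deleted_def is_free_def)
  next
    case False
    obtain w where w: "skey ?s = Some w"
      using False chains_ok_is_free[OF ok i] by (cases "skey ?s") auto
    have us: "is_used ?s" using False w by (auto simp: is_used_def is_deleted_def)
    show ?thesis
    proof (cases "find_free t")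
      case None
      then have "place i x y t = None" using False by (simp add: place_def Let_def)
      then show ?thesis using us None find_free_None_iff[OF assms(1)] by simp
    next
      case (Some f)
      note ff = find_free_SomeD[OF Some lf]
      have fk: "skey (?xs ! f) = None" using chains_ok_is_free[OF ok ff(1)] ff(2) by simp
      have fi: "f \<noteq> i" using fk w by auto
      have fu: "\<not> is_used (?xs ! f)" using fk by (simp add: is_used_def)
      define ys where "ys = (if hash t w = Some i
        then ?xs[f := \<lparr>skey = Some x, sval = Some y, snext = snext ?s\<rparr>, i := ?s\<lparr>snext := Some f\<rparr>]
        else (relink (predecessor t w i) f ?xs)[f := ?s, i := \<lparr>skey = Some x, sval = Some y, snext = None\<rparr>])"
      have pl: "place i x y t = Some (t\<lparr>lastfree := int f, slots := ys\<rparr>)"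
        using False Some w by (simp add: place_def Let_def ys_def)
      have ok': "chains_ok ys (hash t)"
      proof (cases "hash t w = Some i")
        case True
        then show ?thesis
          unfolding ys_def using chains_ok_link_second[OF ok i assms(3) fresh ff(1) fk w True] by simp
      next
        case False
        obtain p where p: "predecessor t w i = Some p" "(p, i) \<in> links ?xs" "p \<noteq> i"
          using predecessor_stored[OF ok i w False] .
        show ?thesis
          unfolding ys_def using False p(1) chains_ok_move[OF ok i assms(3) fresh ff(1) fk w False p(2,3)]
          by (simp add: relink_def)
      qed
      have len: "length ys = length ?xs" by (simp add: ys_def relink_occupancy)
      have occ: "is_free (ys ! j) = (is_free (?xs ! j) \<and> j \<noteq> f)" "is_used (ys ! j) = (is_used (?xs ! j) \<or> j = f)"
        if "j < length ?xs" for j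
        using that ff(1) i fi us by (auto simp: ys_def nth_update_valid relink_occupancy occupancy_simps)
      \<comment> \<open>As far as occupancy is concerned, linking and displacing both act like
        copying the used slot \<open>?s\<close> into \<open>f\<close>. The counts thus reduce to a
        single list update.\<close>
      have cnt: "length (filter P ys) = length (filter P (?xs[f := a]))"
        if "\<And>j. j < length ?xs \<Longrightarrow> P (ys ! j) = P (?xs[f := a] ! j)" for P a
      proof -
        have "map P ys = map P (?xs[f := a])" by (rule nth_equalityI) (use len that in auto)
        then have "length (filter (\<lambda>b. b) (map P ys)) = length (filter (\<lambda>b. b) (map P (?xs[f := a])))" by simp
        then show ?thesis by (simp only: filter_map length_map o_def)
      qed
      have cu: "length (filter is_used ys) = length (filter is_used (?xs[f := ?s]))"
        by (rule cnt) (use occ us in \<open>auto simp: nth_update_valid\<close>)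
      have cf: "length (filter is_free ys) = length (filter is_free (?xs[f := ?s]))"
        by (rule cnt) (use occ us in \<open>auto simp: nth_update_valid occupancy_simps(5)\<close>)
      have "\<not> is_free (ys ! j)" if "j < length ?xs" "int f < int j" for j
        using occ(1)[OF that(1)] nf[OF that(1)] ff(4)[OF that(1,2)] by force
      then have "wf_hashmap (t\<lparr>lastfree := int f, slots := ys\<rparr>)"
        using ok' len ff(1) by (simp add: wf_hashmap_def)
      then show ?thesis
        using pl len cu cf length_filter_update[OF ff(1), of is_used ?s]
          length_filter_update[OF ff(1), of is_free ?s] us fu ff(2) False
        by (auto simp: nused_def nfree_def occupancy_simps(5))
    qed
  qed
qed

text \<open>\<open>stored\<close> only consults keys whose hash value is already recorded, so
  recording one for \<open>x\<close> changes nothing it relies on.\<close>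

lemma wf_hashmap_hash_upd:
  assumes "wf_hashmap t" "hash t x = None" "i < length (slots t)"
  shows "wf_hashmap (t\<lparr>hash := (hash t)(x \<mapsto> i)\<rparr>)"
proof -
  have ok: "chains_ok (slots t) (hash t)" using assms(1) by (simp add: wf_hashmap_def)
  have "stored (slots t) ((hash t)(x \<mapsto> i)) j z" if "stored (slots t) (hash t) j z" for j z
  proof -
    obtain h u where "hash t z = Some h" "h < length (slots t)" "(h, j) \<in> (links (slots t))\<^sup>*"
      "skey (slots t ! h) = Some u" "hash t u = Some h"
      using \<open>stored _ _ _ _\<close> unfolding stored_def by blast
    moreover then have "z \<noteq> x" "u \<noteq> x" using assms(2) by auto
    ultimately show ?thesis unfolding stored_def by auto
  qed
  note st = this
  note D = chains_okD[OF ok]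
  have "chains_ok (slots t) ((hash t)(x \<mapsto> i))"
  proof (rule chains_okI)
    show "sval (slots t ! j) = None \<and> snext (slots t ! j) = None"
      if "j < length (slots t)" "skey (slots t ! j) = None" for j using D(1,2)[OF that] by simp
    show "stored (slots t) ((hash t)(x \<mapsto> i)) j z"
      if "j < length (slots t)" "skey (slots t ! j) = Some z" for j z using st[OF D(3)[OF that]] .
    show "b < length (slots t) \<and> skey (slots t ! b) \<noteq> None" if "(a, b) \<in> links (slots t)" for a b
      using D(5,6)[OF that] by simp
  qed (fact D(4) D(7))+
  then show ?thesis using assms(1) by (simp add: wf_hashmap_def)
qed

lemma wf_hashmap_fresh:
  assumes "wf_hashmap t" "hash t x = None" "j < length (slots t)"
  shows "skey (slots t ! j) \<noteq> Some x"
  using chains_okD(3)[of "slots t" "hash t" j x] assms by (auto simp: wf_hashmap_def stored_def)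

lemma wf_new_hashmap: "wf_hashmap (new_hashmap M)"
  by (auto simp: wf_hashmap_def new_hashmap_def chains_ok_def links_def)

lemma used_keysE:
  assumes "x \<in> used_keys t"
  obtains j where "j < length (slots t)" "is_used (slots t ! j)" "skey (slots t ! j) = Some x"
  using assms by (auto simp: used_keys_def in_set_conv_nth)

lemma finite_used_keys: "finite (used_keys t)"
proof -
  have "used_keys t \<subseteq> (\<lambda>s. the (skey s)) ` set (slots t)"
    by (auto simp: used_keys_def image_iff) (metis option.sel)
  then show ?thesis by (rule finite_subset) simp
qed

lemma used_keys_empty_iff: "used_keys t = {} \<longleftrightarrow> nused t = 0"
  unfolding used_keys_def nused_def length_0_conv filter_empty_conv is_used_def
  by (auto simp del: not_None_eq) (metis not_None_eq)

lemma delete_used: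
  assumes "wf_hashmap t" "x \<in> used_keys t"
  shows "wf_hashmap (delete x t) \<and> Suc (nused (delete x t)) = nused t \<and> nfree (delete x t) = nfree t \<and>
    length (slots (delete x t)) = length (slots t) \<and> hash (delete x t) = hash t"
proof -
  obtain j where j: "j < length (slots t)" "is_used (slots t ! j)" "skey (slots t ! j) = Some x"
    using used_keysE[OF assms(2)] .
  have ok: "chains_ok (slots t) (hash t)" using assms(1) by (simp add: wf_hashmap_def)
  define s' where "s' = (slots t ! j)\<lparr>sval := None\<rparr>"
  have d: "delete x t = t\<lparr>slots := (slots t)[j := s']\<rparr>"
    using search_stored[OF ok j(1,3)] by (simp add: delete_def s'_def)
  have s': "\<not> is_used s'" "\<not> is_free s'" "\<not> is_free (slots t ! j)"
    using j by (auto simp: s'_def is_used_def is_free_def)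
  have "\<not> is_free ((slots t)[j := s'] ! k)" if "k < length (slots t)" "lastfree t < int k" for k
    using assms(1) s'(2) that by (simp add: nth_update_valid wf_hashmap_def)
  then have "wf_hashmap (delete x t)"
    using assms(1) chains_ok_clear_value[OF ok, of j] by (simp add: wf_hashmap_def d s'_def)
  then show ?thesis
    using d length_filter_update[OF j(1), of is_used s'] length_filter_update[OF j(1), of is_free s'] s' j(2)
    by (auto simp: nused_def nfree_def)
qed

lemma used_pairs_fresh:
  assumes "wf_hashmap t" "(x, y) \<in> set (used_pairs t)"
  shows "hash t x \<noteq> None"
proof -
  obtain j where j: "j < length (slots t)" "is_used (slots t ! j)" "x = the (skey (slots t ! j))"
    using assms(2) by (auto simp: used_pairs_def in_set_conv_nth)
  then have "skey (slots t ! j) = Some x" by (auto simp: is_used_def)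
  then show ?thesis using wf_hashmap_fresh[OF assms(1) _ j(1)] by blast
qed

lemma length_used_pairs: "length (used_pairs t) = nused t"
  by (simp add: used_pairs_def nused_def)

lemma distinct_used_pairs:
  assumes "wf_hashmap t"
  shows "distinct (map fst (used_pairs t))"
proof -
  have D: "\<And>i j x. i < length (slots t) \<Longrightarrow> j < length (slots t) \<Longrightarrow> skey (slots t ! i) = Some x \<Longrightarrow>
      skey (slots t ! j) = Some x \<Longrightarrow> i = j"
    using chains_okD(4)[of "slots t" "hash t"] assms by (auto simp: wf_hashmap_def)
  have "distinct (map (\<lambda>s. the (skey s)) (filter is_used xs))"
    if "\<And>i j x. i < length xs \<Longrightarrow> j < length xs \<Longrightarrow> skey (xs ! i) = Some x \<Longrightarrow>
      skey (xs ! j) = Some x \<Longrightarrow> i = j" for xs :: "('a, 'b) slot list"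
    using that
  proof (induction xs)
    case (Cons s xs)
    have 1: "distinct (map (\<lambda>s. the (skey s)) (filter is_used xs))"
    proof (rule Cons.IH)
      fix i j x assume "i < length xs" "j < length xs" "skey (xs ! i) = Some x" "skey (xs ! j) = Some x"
      then show "i = j" using Cons.prems[of "Suc i" "Suc j" x] by simp
    qed
    have "the (skey s') \<noteq> the (skey s)" if s: "is_used s" "s' \<in> set xs" "is_used s'" for s'
    proof
      assume e: "the (skey s') = the (skey s)"
      obtain k where "k < length xs" "s' = xs ! k" using s(2) by (auto simp: in_set_conv_nth)
      then show False
        using Cons.prems[of 0 "Suc k" "the (skey s)"] s e by (auto simp: is_used_def)
    qed
    then show ?case using 1 by (auto, metis)
  qed auto
  from this[OF D] show ?thesis by (simp add: used_pairs_def o_def)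
qed

section \<open>Effect of one operation\<close>

text \<open>Only keys inserted so far have a recorded hash value. Hence the next key is absent from
  the array and its main position is still to be drawn uniformly. The bound
  \<open>inserted st \<le> calls st\<close> makes the natural subtraction in \<open>extra\<close>
  exact.\<close>

definition valid :: "(nat \<Rightarrow> 'k) \<Rightarrow> ('k, 'v) run_state \<Rightarrow> bool" where
  "valid key st \<longleftrightarrow> wf_hashmap (hmap st) \<and> dom (hash (hmap st)) \<subseteq> key ` {..<inserted st} \<and>
     inserted st \<le> calls st \<and> (slots (hmap st) = [] \<or> (\<exists>m. length (slots (hmap st)) = 2 ^ m))"

text \<open>Every user insertion accounts for one call of its own, so this counts the calls made by
  rehashes, which carry the logarithmic factor.\<close>

definition extra :: "('k, 'v) run_state \<Rightarrow> nat" where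
  "extra st = calls st - inserted st"

definition used :: "('k, 'v) run_state \<Rightarrow> nat" where
  "used st = nused (hmap st)"

definition free :: "('k, 'v) run_state \<Rightarrow> nat" where
  "free st = nfree (hmap st)"

definition capacity :: "('k, 'v) run_state \<Rightarrow> nat" where
  "capacity st = length (slots (hmap st))"

lemma try_insertE:
  assumes "wf_hashmap t" "slots t \<noteq> []" "hash t x = None" "(r, c) \<in> set_pmf (try_insert x y t)"
  obtains i where "i < length (slots t)" "r = place i x y (t\<lparr>hash := (hash t)(x \<mapsto> i)\<rparr>)"
  using assms
  by (auto simp: try_insert_def main_position_def Let_def set_pmf_of_set lessThan_empty_iff)

lemma place_hash_upd:
  assumes "wf_hashmap t" "hash t x = None" "i < length (slots t)"
  shows "(place i x y (t\<lparr>hash := (hash t)(x \<mapsto> i)\<rparr>) = None \<longrightarrow> nfree t = 0 \<and> is_used (slots t ! i)) \<and>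
    (\<forall>t'. place i x y (t\<lparr>hash := (hash t)(x \<mapsto> i)\<rparr>) = Some t' \<longrightarrow>
      wf_hashmap t' \<and> length (slots t') = length (slots t) \<and>
      hash t' = (hash t)(x \<mapsto> i) \<and> nused t' = Suc (nused t) \<and>
      (if is_deleted (slots t ! i) then nfree t' = nfree t else Suc (nfree t') = nfree t))"
  using place_cases[OF wf_hashmap_hash_upd[OF assms], of i x y] wf_hashmap_fresh[OF assms(1,2)] assms(3)
  by (auto simp: nused_def nfree_def)

lemma reinsert_support:
  assumes "wf_hashmap (hmap st)" "distinct (map fst ps)"
    "\<And>x y. (x, y) \<in> set ps \<Longrightarrow> hash (hmap st) x = None"
    "used st + free st = capacity st" "used st + length ps \<le> capacity st"
    "st' \<in> set_pmf (reinsert ps st)"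
  shows "wf_hashmap (hmap st') \<and> capacity st' = capacity st \<and> used st' = used st + length ps \<and>
    calls st' = calls st + length ps \<and> inserted st' = inserted st \<and>
    dom (hash (hmap st')) = dom (hash (hmap st)) \<union> fst ` set ps"
  using assms
proof (induction ps st rule: reinsert.induct)
  case (1 st)
  then show ?case by simp
next
  case (2 x y ps st)
  let ?t = "hmap st"
  from "2.prems"(6) obtain r d where rd: "(r, d) \<in> set_pmf (try_insert x y ?t)"
    "st' \<in> set_pmf (reinsert ps (st\<lparr>hmap := (case r of None \<Rightarrow> ?t | Some t \<Rightarrow> t),
                     calls := calls st + 1, steps := steps st + d\<rparr>))"
    by auto
  have hx: "hash ?t x = None" by (rule "2.prems"(3)[of x y]) simp
  have ne: "slots ?t \<noteq> []" using "2.prems"(5) by (auto simp: capacity_def)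
  obtain i where i: "i < length (slots ?t)" "r = place i x y (?t\<lparr>hash := (hash ?t)(x \<mapsto> i)\<rparr>)"
    using try_insertE[OF "2.prems"(1) ne hx rd(1)] .
  note P = place_hash_upd[OF "2.prems"(1) hx i(1), of y, folded i(2)]
  have "nfree ?t > 0" using "2.prems"(4,5) by (auto simp: used_def free_def)
  then obtain t' where t': "r = Some t'" using P by (cases r) auto
  \<comment> \<open>Recycling a deleted slot would raise \<open>nused\<close> without lowering
    \<open>nfree\<close>, and their sum, already equal to the number of slots, would exceed
    it.\<close>
  have nd: "\<not> is_deleted (slots ?t ! i)"
  proof
    assume d: "is_deleted (slots ?t ! i)"
    have "nused t' + nfree t' \<le> length (slots t')" by (rule nused_nfree_le)
    then show False using P t' d "2.prems"(4) by (auto simp: used_def free_def capacity_def)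
  qed
  let ?st = "st\<lparr>hmap := t', calls := calls st + 1, steps := steps st + d\<rparr>"
  have "wf_hashmap (hmap st') \<and> capacity st' = capacity ?st \<and> used st' = used ?st + length ps \<and>
    calls st' = calls ?st + length ps \<and> inserted st' = inserted ?st \<and>
    dom (hash (hmap st')) = dom (hash (hmap ?st)) \<union> fst ` set ps"
  proof (rule "2.IH"[OF rd(1) refl, unfolded t' option.case])
    show "wf_hashmap (hmap ?st)" using P t' by simp
    show "distinct (map fst ps)" using "2.prems"(2) by simp
    show "hash (hmap ?st) z = None" if "(z, u) \<in> set ps" for z u
      using "2.prems"(2,3) P t' that by (auto simp: image_iff)
    show "used ?st + free ?st = capacity ?st" "used ?st + length ps \<le> capacity ?st"
      using P t' nd "2.prems"(4,5) by (auto simp: used_def free_def capacity_def)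
    show "st' \<in> set_pmf (reinsert ps ?st)" using rd(2) t' by simp
  qed
  then show ?case using P t' by (auto simp: used_def capacity_def)
qed

text \<open>The last part is what keeps the process at one array size: as soon as
  \<open>Suc (nused t)\<close> exceeds half of \<open>2 ^ m\<close> and still fits, a rehash chooses
  \<open>2 ^ m\<close>.\<close>

lemma rehash_size_props:
  shows "\<exists>m. rehash_size t = 2 ^ m" "Suc (nused t) \<le> rehash_size t"
    "Suc (nused t) \<le> 2 ^ m \<Longrightarrow> rehash_size t \<le> 2 ^ m"
    "Suc (nused t) \<le> 2 ^ m \<Longrightarrow> 2 ^ m < 2 * Suc (nused t) \<Longrightarrow> rehash_size t = 2 ^ m"
proof -
  define P where "P m \<longleftrightarrow> nused t + 1 \<le> 2 ^ m" for m
  have r: "rehash_size t = 2 ^ (LEAST m. P m)" by (simp add: rehash_size_def P_def nused_def)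
  have "P (nused t)" unfolding P_def by (metis Suc_eq_plus1 Suc_leI less_exp)
  then have "P (LEAST m. P m)" by (rule LeastI)
  then show 1: "Suc (nused t) \<le> rehash_size t" by (simp add: r P_def)
  show "\<exists>m. rehash_size t = 2 ^ m" using r by blast
  show 2: "rehash_size t \<le> 2 ^ m" if "Suc (nused t) \<le> 2 ^ m" for m
    unfolding r using that by (intro power_increasing Least_le) (auto simp: P_def)
  assume a: "Suc (nused t) \<le> 2 ^ m" "2 ^ m < 2 * Suc (nused t)"
  have "(2::nat) ^ m < 2 ^ Suc (LEAST m. P m)" using a(2) 1 by (simp add: r)
  then have "m \<le> (LEAST m. P m)" by (metis less_Suc_eq_le numeral_One one_less_numeral_iff power_less_imp_less_exp semiring_norm(76))
  moreover have "(LEAST m. P m) \<le> m" using a(1) by (intro Least_le) (simp add: P_def)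
  ultimately show "rehash_size t = 2 ^ m" unfolding r by simp
qed

lemma rehash_support:
  assumes "wf_hashmap (hmap st)" "hash (hmap st) x = None" "st' \<in> set_pmf (rehash x y st)"
  shows "wf_hashmap (hmap st') \<and> capacity st' = rehash_size (hmap st) \<and> used st' = Suc (used st) \<and>
    calls st' = calls st + Suc (used st) \<and> inserted st' = inserted st \<and>
    dom (hash (hmap st')) \<subseteq> insert x (dom (hash (hmap st)))"
proof -
  let ?t = "hmap st" and ?M = "rehash_size (hmap st)"
  let ?ps = "used_pairs ?t @ [(x, y)]"
  let ?st = "st\<lparr>hmap := new_hashmap ?M, steps := steps st + length (slots ?t) + ?M\<rparr>"
  have n: "nused (hmap ?st) = 0" "nfree (hmap ?st) = ?M" "length (slots (hmap ?st)) = ?M"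
    "hash (hmap ?st) = Map.empty"
    by (auto simp: nused_def nfree_def new_hashmap_def is_used_def is_free_def filter_empty_conv)
  have "wf_hashmap (hmap st') \<and> capacity st' = capacity ?st \<and> used st' = used ?st + length ?ps \<and>
    calls st' = calls ?st + length ?ps \<and> inserted st' = inserted ?st \<and>
    dom (hash (hmap st')) = dom (hash (hmap ?st)) \<union> fst ` set ?ps"
  proof (rule reinsert_support)
    show "wf_hashmap (hmap ?st)" by (simp add: wf_new_hashmap)
    have "x \<notin> fst ` set (used_pairs ?t)" using used_pairs_fresh[OF assms(1)] assms(2) by fastforce
    then show "distinct (map fst ?ps)" using distinct_used_pairs[OF assms(1)] by auto
    show "hash (hmap ?st) z = None" for z using n(4) by simp
    show "used ?st + free ?st = capacity ?st" using n by (simp add: used_def free_def capacity_def)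
    show "used ?st + length ?ps \<le> capacity ?st"
      using n rehash_size_props(2)[of ?t] by (simp add: used_def capacity_def length_used_pairs)
    show "st' \<in> set_pmf (reinsert ?ps ?st)" using assms(3) by (simp add: rehash_def Let_def)
  qed
  moreover have "fst ` set (used_pairs ?t) \<subseteq> dom (hash ?t)"
    using used_pairs_fresh[OF assms(1)] by force
  ultimately show ?thesis using n by (auto simp: used_def capacity_def length_used_pairs)
qed

text \<open>The main position is a parameter here, so that the uniform draw can be averaged slot by
  slot, separating deleted slots from the others.\<close>

definition insert_at :: "(nat \<Rightarrow> 'k) \<Rightarrow> (nat \<Rightarrow> 'v) \<Rightarrow> ('k, 'v) run_state \<Rightarrow> nat \<Rightarrow> ('k, 'v) run_state pmf" where
  "insert_at key val st i =
     (let x = key (inserted st); y = val (inserted st); t = (hmap st)\<lparr>hash := (hash (hmap st))(x \<mapsto> i)\<rparr>;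
        st' = st\<lparr>inserted := inserted st + 1, calls := calls st + 1, steps := steps st + Suc (place_steps i t)\<rparr>
      in case place i x y t of
           Some t' \<Rightarrow> return_pmf (st'\<lparr>hmap := t'\<rparr>)
         | None \<Rightarrow> rehash x y st')"

lemma valid_new_key:
  assumes "inj key" "valid key st"
  shows "hash (hmap st) (key (inserted st)) = None"
proof -
  have "key (inserted st) \<notin> key ` {..<inserted st}" using assms(1) by (auto dest: injD)
  then show ?thesis using assms(2) by (auto simp: valid_def)
qed

text \<open>The hash value of a new key has not been drawn yet, so \<open>main_position\<close>
  takes its random branch.\<close>

lemma random_insert_eq:
  assumes "inj key" "valid key st" "slots (hmap st) \<noteq> []"
  shows "random_insert key val st = pmf_of_set {..<capacity st} \<bind> insert_at key val st"
  using valid_new_key[OF assms(1,2)] assms(3)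
  by (simp add: random_insert_def lua_insert_def try_insert_def main_position_def insert_at_def[abs_def]
      capacity_def Let_def bind_assoc_pmf bind_return_pmf cong: option.case_cong)

lemma valid_after_rehash:
  assumes "inj key" "valid key st"
    "st' \<in> set_pmf (rehash (key (inserted st)) y
      (st\<lparr>inserted := inserted st + 1, calls := calls st + 1, steps := s\<rparr>))"
  shows "valid key st' \<and> used st' = Suc (used st) \<and> capacity st' = rehash_size (hmap st) \<and>
     extra st' = extra st + Suc (used st)"
proof -
  have w: "wf_hashmap (hmap (st\<lparr>inserted := inserted st + 1, calls := calls st + 1, steps := s\<rparr>))"
    using assms(2) by (simp add: valid_def)
  have n: "hash (hmap (st\<lparr>inserted := inserted st + 1, calls := calls st + 1, steps := s\<rparr>)) (key (inserted st)) = None"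
    using valid_new_key[OF assms(1,2)] by simp
  note R = rehash_support[OF w n assms(3)]
  have "dom (hash (hmap st')) \<subseteq> insert (key (inserted st)) (key ` {..<inserted st})"
    using R assms(2) unfolding valid_def by (simp, blast)
  then have "dom (hash (hmap st')) \<subseteq> key ` {..<Suc (inserted st)}" by (simp add: lessThan_Suc)
  moreover have "\<exists>m. capacity st' = 2 ^ m" using R rehash_size_props(1)[of "hmap st"] by simp
  ultimately show ?thesis using R assms(2) by (auto simp: valid_def extra_def used_def capacity_def)
qed

lemma insert_at_support:
  assumes "inj key" "valid key st" "i < capacity st" "st' \<in> set_pmf (insert_at key val st i)"
  shows "valid key st' \<and> used st' = Suc (used st) \<and>
    (capacity st' = capacity st \<and> extra st' = extra st \<and>
       (if is_deleted (slots (hmap st) ! i) then free st' = free st else Suc (free st') = free st) \<or>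
     capacity st' = rehash_size (hmap st) \<and> extra st' = extra st + Suc (used st))"
proof -
  let ?x = "key (inserted st)" and ?y = "val (inserted st)" and ?t = "hmap st"
  let ?t' = "?t\<lparr>hash := (hash ?t)(?x \<mapsto> i)\<rparr>"
  have i: "i < length (slots ?t)" using assms(3) by (simp add: capacity_def)
  have wf: "wf_hashmap ?t" using assms(2) by (simp add: valid_def)
  note P = place_hash_upd[OF wf valid_new_key[OF assms(1,2)] i, of ?y]
  show ?thesis
  proof (cases "place i ?x ?y ?t'")
    case None
    then show ?thesis
      using assms(4) valid_after_rehash[OF assms(1,2)] by (auto simp: insert_at_def Let_def)
  next
    case (Some t')
    then have st': "st' = st\<lparr>inserted := inserted st + 1, calls := calls st + 1,
        steps := steps st + Suc (place_steps i ?t'), hmap := t'\<rparr>"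
      using assms(4) by (simp add: insert_at_def Let_def)
    have "dom (hash t') \<subseteq> key ` {..<Suc (inserted st)}"
      using P Some assms(2) by (auto simp: valid_def lessThan_Suc)
    then show ?thesis
      using P Some assms(2) unfolding st'
      by (auto simp: valid_def extra_def used_def free_def capacity_def)
  qed
qed

lemma random_insert_support:
  assumes "inj key" "valid key st" "st' \<in> set_pmf (random_insert key val st)"
  shows "valid key st' \<and> used st' = Suc (used st) \<and>
    (capacity st' = capacity st \<and> extra st' = extra st \<or>
     capacity st' = rehash_size (hmap st) \<and> extra st' = extra st + Suc (used st))"
proof (cases "slots (hmap st) = []")
  case True
  then have "st' \<in> set_pmf (rehash (key (inserted st)) (val (inserted st))
      (st\<lparr>inserted := inserted st + 1, calls := calls st + 1, steps := steps st + 1\<rparr>))"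
    using assms(3) by (simp add: random_insert_def lua_insert_def try_insert_def bind_return_pmf)
  from valid_after_rehash[OF assms(1,2) this] show ?thesis by simp
next
  case False
  then have "capacity st > 0" by (simp add: capacity_def)
  then obtain i where "i < capacity st" "st' \<in> set_pmf (insert_at key val st i)"
    using assms(3) random_insert_eq[OF assms(1,2) False]
    by (auto simp: set_pmf_of_set lessThan_empty_iff)
  from insert_at_support[OF assms(1,2) this] show ?thesis by auto
qed

lemma random_delete_support:
  assumes "valid key st" "used st > 0" "st' \<in> set_pmf (random_delete st)"
  shows "valid key st' \<and> Suc (used st') = used st \<and> capacity st' = capacity st \<and>
    extra st' = extra st \<and> free st' = free st"
proof -
  have wf: "wf_hashmap (hmap st)" using assms(1) by (simp add: valid_def)
  have "used_keys (hmap st) \<noteq> {}" using assms(2) used_keys_empty_iff[of "hmap st"] by (simp add: used_def)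
  then obtain x where x: "x \<in> used_keys (hmap st)"
      "st' = st\<lparr>hmap := delete x (hmap st), steps := steps st + delete_steps x (hmap st)\<rparr>"
    using assms(3) by (auto simp: random_delete_def set_pmf_of_set finite_used_keys)
  from delete_used[OF wf x(1)] assms(1) show ?thesis
    unfolding x(2) by (auto simp: valid_def used_def capacity_def extra_def free_def)
qed

lemma used_free_le: "used st + free st \<le> capacity st"
  using nused_nfree_le by (simp add: used_def free_def capacity_def)

section \<open>Finite support, and running time against number of calls\<close>

lemma finite_bind_pmf_all:
  assumes "finite (set_pmf q)"
    "\<And>x. x \<in> set_pmf q \<Longrightarrow> finite (set_pmf (f x)) \<and> (\<forall>y\<in>set_pmf (f x). P y)"
  shows "finite (set_pmf (q \<bind> f)) \<and> (\<forall>y\<in>set_pmf (q \<bind> f). P y)"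
  using assms by auto

lemma try_insert_finite: "finite (set_pmf (try_insert x y t))"
  by (auto simp: try_insert_def main_position_def Let_def set_pmf_of_set lessThan_empty_iff split: option.split)

lemma try_insert_steps:
  assumes "(r, c) \<in> set_pmf (try_insert x y t)"
  shows "1 \<le> c"
  using assms by (auto simp: try_insert_def Let_def split: if_splits)

lemma reinsert_finite_steps:
  assumes "calls st \<le> steps st"
  shows "finite (set_pmf (reinsert ps st)) \<and> (\<forall>st'\<in>set_pmf (reinsert ps st). calls st' \<le> steps st')"
  using assms
proof (induction ps st rule: reinsert.induct)
  case (2 x y ps st)
  show ?case
    unfolding reinsert.simps
  proof (rule finite_bind_pmf_all[OF try_insert_finite], unfold case_prod_beta)
    fix rc assume rc: "rc \<in> set_pmf (try_insert x y (hmap st))"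
    then have r: "(fst rc, snd rc) \<in> set_pmf (try_insert x y (hmap st))" by simp
    let ?s = "st\<lparr>hmap := (case fst rc of None \<Rightarrow> hmap st | Some t \<Rightarrow> t), calls := calls st + 1, steps := steps st + snd rc\<rparr>"
    show "finite (set_pmf (reinsert ps ?s)) \<and> (\<forall>st'\<in>set_pmf (reinsert ps ?s). calls st' \<le> steps st')"
      by (rule "2.IH"[OF rc, of "fst rc" "snd rc"]) (use try_insert_steps[OF r] "2.prems" in auto)
  qed
qed simp

lemma rehash_finite_steps:
  assumes "calls st \<le> steps st"
  shows "finite (set_pmf (rehash x y st)) \<and> (\<forall>st'\<in>set_pmf (rehash x y st). calls st' \<le> steps st')"
  unfolding rehash_def Let_def using assms by (intro reinsert_finite_steps) simp

lemma random_insert_finite_steps: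
  assumes "calls st \<le> steps st"
  shows "finite (set_pmf (random_insert key val st)) \<and>
    (\<forall>st'\<in>set_pmf (random_insert key val st). calls st' \<le> steps st')"
proof -
  let ?st = "st\<lparr>inserted := inserted st + 1\<rparr>"
  define f where "f = (\<lambda>(r, c). let st' = ?st\<lparr>calls := calls ?st + 1, steps := steps ?st + c\<rparr> in
    case r of Some t \<Rightarrow> return_pmf (st'\<lparr>hmap := t\<rparr>)
    | None \<Rightarrow> rehash (key (inserted st)) (val (inserted st)) st')"
  have eq: "random_insert key val st = try_insert (key (inserted st)) (val (inserted st)) (hmap ?st) \<bind> f"
    unfolding random_insert_def lua_insert_def f_def ..
  have "finite (set_pmf (f rc)) \<and> (\<forall>st'\<in>set_pmf (f rc). calls st' \<le> steps st')"
    if "rc \<in> set_pmf (try_insert (key (inserted st)) (val (inserted st)) (hmap ?st))" for rc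
  proof (cases rc)
    case (Pair r c)
    have "1 \<le> c" by (rule try_insert_steps) (use that Pair in simp)
    show ?thesis
    proof (cases r)
      case None
      show ?thesis
        unfolding Pair None f_def Let_def prod.case option.case
        by (rule rehash_finite_steps) (use \<open>1 \<le> c\<close> assms in simp)
    next
      case (Some t)
      then show ?thesis using Pair \<open>1 \<le> c\<close> assms by (simp add: f_def)
    qed
  qed
  then show ?thesis unfolding eq by (rule finite_bind_pmf_all[OF try_insert_finite])
qed

lemma random_operation_finite_steps:
  assumes "calls st \<le> steps st"
  shows "finite (set_pmf (random_operation key val p st)) \<and>
    (\<forall>st'\<in>set_pmf (random_operation key val p st). calls st' \<le> steps st')"
proof -
  have d: "finite (set_pmf (random_delete st)) \<and> (\<forall>st'\<in>set_pmf (random_delete st). calls st' \<le> steps st')"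
    if "used_keys (hmap st) \<noteq> {}"
    unfolding random_delete_def
    by (rule finite_bind_pmf_all) (use that assms in \<open>simp_all add: finite_used_keys\<close>)
  show ?thesis
  proof (cases "used_keys (hmap st) = {}")
    case True
    then show ?thesis using random_insert_finite_steps[OF assms] by (simp add: random_operation_def bind_return_pmf)
  next
    case False
    show ?thesis
      unfolding random_operation_def
    proof (rule finite_bind_pmf_all)
      show "finite (set_pmf (if used_keys (hmap st) = {} then return_pmf True else bernoulli_pmf p))"
        by (rule finite)
      show "finite (set_pmf (if c then random_insert key val st else random_delete st)) \<and>
          (\<forall>st'\<in>set_pmf (if c then random_insert key val st else random_delete st). calls st' \<le> steps st')" for c
        using random_insert_finite_steps[OF assms, of key val] d[OF False] by (cases c) simp_all
    qed
  qed
qed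

text \<open>Finite support supplies the integrability behind the expected running time. The
  inequality transfers the tail bound from calls to steps.\<close>

lemma run_finite_steps:
  "finite (set_pmf (run key val p T)) \<and> (\<forall>st\<in>set_pmf (run key val p T). calls st \<le> steps st)"
proof (induction T)
  case (Suc T)
  then show ?case
    unfolding run.simps using random_operation_finite_steps by (intro finite_bind_pmf_all) blast+
qed simp

text \<open>Markov's inequality, read as a lower bound on the expectation.\<close>

lemma expectation_ge:
  fixes f :: "'a \<Rightarrow> real"
  assumes "finite (set_pmf q)" "\<And>x. x \<in> set_pmf q \<Longrightarrow> 0 \<le> f x" "0 \<le> a"
  shows "a * (1 - measure_pmf.prob q {x. \<not> a \<le> f x}) \<le> measure_pmf.expectation q f"
proof -
  have "measure_pmf.prob q (- {x. \<not> a \<le> f x}) = 1 - measure_pmf.prob q {x. \<not> a \<le> f x}"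
    using measure_pmf.prob_compl[of "{x. \<not> a \<le> f x}" q] by (simp add: Compl_eq_Diff_UNIV)
  moreover have "- {x. \<not> a \<le> f x} = {x. a \<le> f x}" by auto
  ultimately have "a * (1 - measure_pmf.prob q {x. \<not> a \<le> f x}) = measure_pmf.expectation q (\<lambda>x. a * indicator {x. a \<le> f x} x)"
    by simp
  also have "\<dots> \<le> measure_pmf.expectation q f"
    using assms by (intro integral_mono_AE integrable_measure_pmf_finite)
      (auto simp: AE_measure_pmf_iff indicator_def)
  finally show ?thesis .
qed

section \<open>The random process\<close>

text \<open>The process of \<open>run\<close>, but from an arbitrary state and unfolding the
  earliest operation. Inductions can so condition on the first step, and a phase can start in the
  middle of a run.\<close>

fun operations :: "(nat \<Rightarrow> 'k) \<Rightarrow> (nat \<Rightarrow> 'v) \<Rightarrow> real \<Rightarrow> nat \<Rightarrow> ('k, 'v) run_state \<Rightarrow> ('k, 'v) run_state pmf" where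
  "operations key val p 0 st = return_pmf st"
| "operations key val p (Suc n) st = random_operation key val p st \<bind> operations key val p n"

lemma operations_add:
  "operations key val p (m + n) st = operations key val p m st \<bind> operations key val p n"
proof (induction m arbitrary: st)
  case (Suc m)
  have "operations key val p (m + n) = (\<lambda>s. operations key val p m s \<bind> operations key val p n)"
    by (rule ext) (rule Suc.IH)
  then show ?case by (simp add: bind_assoc_pmf)
qed (simp add: bind_return_pmf)

lemma run_eq_operations:
  "run key val p T = operations key val p T \<lparr>hmap = empty_hashmap, inserted = 0, calls = 0, steps = 0\<rparr>"
proof (induction T)
  case (Suc T)
  have "operations key val p 1 = random_operation key val p"
    by (rule ext) (simp add: bind_return_pmf' operations.simps(1)[abs_def])
  then show ?case using Suc operations_add[of key val p T 1] by simp
qed simp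

section \<open>Probabilities of composed distributions\<close>

lemma prob_bind_pmf:
  "measure_pmf.prob (bind_pmf q f) A = measure_pmf.expectation q (\<lambda>x. measure_pmf.prob (f x) A)"
proof -
  have int: "integrable (measure_pmf q) (\<lambda>x. measure_pmf.prob (f x) A)"
    by (rule measure_pmf.integrable_const_bound[where B = 1]) auto
  have "ennreal (measure_pmf.prob (bind_pmf q f) A) = (\<integral>\<^sup>+x. ennreal (measure_pmf.prob (f x) A) \<partial>measure_pmf q)"
    by (simp add: measure_pmf.emeasure_eq_measure[symmetric])
  also have "\<dots> = ennreal (measure_pmf.expectation q (\<lambda>x. measure_pmf.prob (f x) A))"
    by (rule nn_integral_eq_integral[OF int]) auto
  finally show ?thesis by (simp add: integral_nonneg)
qed

text \<open>A union bound across two times: either the intermediate state is bad, or the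
  continuation fails. It glues consecutive phases.\<close>

lemma prob_bind_pmf_le_bad:
  assumes "\<And>x. x \<in> set_pmf q \<Longrightarrow> x \<notin> B \<Longrightarrow> measure_pmf.prob (f x) A \<le> c" "0 \<le> c"
  shows "measure_pmf.prob (bind_pmf q f) A \<le> measure_pmf.prob q B + c"
proof -
  have "measure_pmf.expectation q (\<lambda>x. measure_pmf.prob (f x) A) \<le> measure_pmf.expectation q (\<lambda>x. indicator B x + c)"
  proof (rule integral_mono_AE)
    show "integrable (measure_pmf q) (\<lambda>x. measure_pmf.prob (f x) A)"
      by (rule measure_pmf.integrable_const_bound[where B = 1]) auto
    show "integrable (measure_pmf q) (\<lambda>x. indicator B x + c)"
      by (rule Bochner_Integration.integrable_add) (auto simp: measure_pmf.emeasure_eq_measure)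
    show "AE x in measure_pmf q. measure_pmf.prob (f x) A \<le> indicator B x + c"
      using assms by (auto simp: AE_measure_pmf_iff indicator_def intro: order_trans[OF measure_pmf.prob_le_1])
  qed
  also have "\<dots> = measure_pmf.prob q B + c"
    by (subst Bochner_Integration.integral_add) (auto simp: measure_pmf.emeasure_eq_measure)
  finally show ?thesis by (simp add: prob_bind_pmf)
qed

lemma prob_bind_pmf_le:
  assumes "\<And>x. x \<in> set_pmf q \<Longrightarrow> measure_pmf.prob (f x) A \<le> c"
  shows "measure_pmf.prob (bind_pmf q f) A \<le> c"
proof -
  obtain x where "x \<in> set_pmf q" using set_pmf_not_empty[of q] by blast
  then have "0 \<le> c" using assms[of x] measure_nonneg order_trans by blast
  then show ?thesis using prob_bind_pmf_le_bad[of q "{}" f A c] assms by simp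
qed

lemma prob_bind_bernoulli:
  assumes "0 \<le> p" "p \<le> 1"
  shows "measure_pmf.prob (bind_pmf (bernoulli_pmf p) f) A =
    p * measure_pmf.prob (f True) A + (1 - p) * measure_pmf.prob (f False) A"
  unfolding prob_bind_pmf using assms by simp

lemma prob_bind_pmf_of_set:
  assumes "finite S" "S \<noteq> {}"
  shows "measure_pmf.prob (bind_pmf (pmf_of_set S) f) A = (\<Sum>x\<in>S. measure_pmf.prob (f x) A) / card S"
  unfolding prob_bind_pmf using assms by (simp add: integral_pmf_of_set)

lemma exp_le_quadratic:
  fixes l :: real
  assumes "0 \<le> l" "l \<le> 1"
  shows "exp l \<le> 1 + l + l\<^sup>2" "exp (- l) \<le> 1 - l + l\<^sup>2"
proof -
  show "exp l \<le> 1 + l + l\<^sup>2" using exp_bound[of l] assms by simp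
  \<comment> \<open>The product equals \<open>1 + l ^ 3\<close>.\<close>
  have "1 \<le> (1 + l) * (1 - l + l\<^sup>2)"
    using assms by (simp add: algebra_simps power2_eq_square)
  also have "\<dots> \<le> exp l * (1 - l + l\<^sup>2)"
  proof (rule mult_right_mono)
    show "0 \<le> 1 - l + l\<^sup>2" using assms zero_le_power2[of l] by linarith
  qed simp
  finally show "exp (- l) \<le> 1 - l + l\<^sup>2" by (simp add: exp_minus field_simps)
qed

section \<open>The operation model and its exponential supermartingales\<close>

locale random_hashmap =
  fixes key :: "nat \<Rightarrow> 'k" and val :: "nat \<Rightarrow> 'v" and p :: real
  assumes inj: "inj key" and p: "1 / 2 < p" "p < 1"
begin

abbreviation "ops \<equiv> operations key val p"
abbreviation "ins \<equiv> random_insert key val"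

lemma operation_cases:
  assumes "valid key st" "st' \<in> set_pmf (random_operation key val p st)"
  shows "st' \<in> set_pmf (ins st) \<or> used st > 0 \<and> st' \<in> set_pmf (random_delete st)"
  using assms(2) p used_keys_empty_iff[of "hmap st"]
  by (auto simp: random_operation_def used_def split: if_splits)

lemma operation_support:
  assumes "valid key st" "st' \<in> set_pmf (random_operation key val p st)"
  shows "valid key st'" "used st \<le> Suc (used st')" "used st' \<le> Suc (used st)"
    "extra st' = extra st \<or> extra st + used st < extra st'"
  using operation_cases[OF assms] random_insert_support[OF inj assms(1), of st' val]
    random_delete_support[OF assms(1), of st'] by auto

text \<open>If a rehash occurs, the first one meets at least \<open>used st - n\<close> used keys,
  since each operation changes their number by one, and it reinserts all of them.\<close>

lemma ops_support:
  assumes "valid key st" "st' \<in> set_pmf (ops n st)"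
  shows "valid key st' \<and> used st \<le> used st' + n \<and> used st' \<le> used st + n \<and>
    (extra st' = extra st \<or> extra st + (used st - n) \<le> extra st')"
  using assms
proof (induction n arbitrary: st)
  case (Suc n)
  then obtain s where s: "s \<in> set_pmf (random_operation key val p st)" "st' \<in> set_pmf (ops n s)"
    by auto
  note S = operation_support[OF Suc.prems(1) s(1)]
  from Suc.IH[OF S(1) s(2)] S show ?case by auto
qed auto

lemma operation_prob:
  assumes "used st > 0"
  shows "measure_pmf.prob (random_operation key val p st \<bind> f) A =
    p * measure_pmf.prob (ins st \<bind> f) A + (1 - p) * measure_pmf.prob (random_delete st \<bind> f) A"
proof -
  have "used_keys (hmap st) \<noteq> {}" using assms used_keys_empty_iff[of "hmap st"] by (simp add: used_def)
  then have "random_operation key val p st \<bind> f =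
      bernoulli_pmf p \<bind> (\<lambda>b. (if b then ins st else random_delete st) \<bind> f)"
    by (simp add: random_operation_def bind_assoc_pmf)
  then show ?thesis using p by (simp add: prob_bind_bernoulli)
qed

lemma operation_prob_empty:
  assumes "used st = 0"
  shows "random_operation key val p st = ins st"
  using assms used_keys_empty_iff[of "hmap st"]
  by (simp add: random_operation_def used_def bind_return_pmf)

lemma operation_prob_le:
  assumes "used st > 0"
    and "measure_pmf.prob (ins st \<bind> f) A \<le> a"
    and "\<And>st'. st' \<in> set_pmf (random_delete st) \<Longrightarrow> measure_pmf.prob (f st') A \<le> b"
  shows "measure_pmf.prob (random_operation key val p st \<bind> f) A \<le> p * a + (1 - p) * b"
  unfolding operation_prob[OF assms(1)] using p assms(2) prob_bind_pmf_le[OF assms(3)]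
  by (intro add_mono mult_left_mono) auto

lemma prob_ops_eq_0:
  assumes "\<And>st'. st' \<in> set_pmf (ops n st) \<Longrightarrow> st' \<notin> A"
  shows "measure_pmf.prob (ops n st) A = 0"
  using assms by (subst measure_pmf_zero_iff) auto

text \<open>Both bounds hold because the right-hand side, as a function of the state and the remaining
  number of operations, is a supermartingale.\<close>

lemma overflow_prob:
  fixes l :: real
  defines "\<rho> \<equiv> p * exp l + (1 - p) * exp (- l)"
  assumes "0 \<le> l" "1 \<le> \<rho>" "valid key st" "capacity st = M" "M + 2 * n \<le> 2 * used st"
  shows "measure_pmf.prob (ops n st) {s. capacity s \<noteq> M \<or> M \<le> used s + j}
    \<le> \<rho> ^ n * exp (l * (real (used st) + real j - real M))" (is "measure_pmf.prob _ ?A \<le> _")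
  using assms(4-6)
proof (induction n arbitrary: st)
  case 0
  show ?case
  proof (cases "M \<le> used st + j")
    case True
    then have "0 \<le> l * (real (used st) + real j - real M)" using assms(2) by simp
    then show ?thesis by (simp add: indicator_def order_trans[OF _ iffD2[OF one_le_exp_iff]])
  next
    case False
    then show ?thesis using 0 by simp
  qed
next
  case (Suc n)
  show ?case
  proof (cases "M \<le> used st + j")
    \<comment> \<open>Here the bound is at least 1. This stops the supermartingale at the first
      overflow, so later changes of the array size need not be followed.\<close>
    case True
    then have "1 \<le> exp (l * (real (used st) + real j - real M))" using assms(2) by simp
    moreover have "1 \<le> \<rho> ^ Suc n" using assms(3) by (rule one_le_power)
    ultimately have "1 * 1 \<le> \<rho> ^ Suc n * exp (l * (real (used st) + real j - real M))"
      by (intro mult_mono) auto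
    then show ?thesis by (intro order_trans[OF measure_pmf.prob_le_1]) simp
  next
    case False
    have u: "used st > 0" using Suc.prems(3) by (cases "used st") auto
    have "M > 0" using False by simp
    then obtain m where m: "M = 2 ^ m" using Suc.prems(1,2) by (auto simp: valid_def capacity_def)
    \<comment> \<open>More than half of the slots are used and at least one is not, so a rehash at
      this point keeps the size.\<close>
    have rs: "rehash_size (hmap st) = M"
      unfolding m by (rule rehash_size_props(4)) (use False Suc.prems(3) m in \<open>auto simp: used_def\<close>)
    have i: "measure_pmf.prob (ins st \<bind> ops n) ?A \<le> \<rho> ^ n * exp (l * (real (used st) + 1 + real j - real M))"
    proof (rule prob_bind_pmf_le)
      fix s assume "s \<in> set_pmf (ins st)"
      then have "valid key s" "used s = Suc (used st)" "capacity s = M"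
        using random_insert_support[OF inj Suc.prems(1), of s val] rs Suc.prems(2) by auto
      then show "measure_pmf.prob (ops n s) ?A \<le> \<rho> ^ n * exp (l * (real (used st) + 1 + real j - real M))"
        using Suc.IH[of s] Suc.prems by (simp add: add_ac)
    qed
    have d: "measure_pmf.prob (ops n s) ?A \<le> \<rho> ^ n * exp (l * (real (used st) - 1 + real j - real M))"
      if "s \<in> set_pmf (random_delete st)" for s
    proof -
      have s: "valid key s" "Suc (used s) = used st" "capacity s = M"
        using random_delete_support[OF Suc.prems(1) u that] Suc.prems(2) by auto
      moreover have "real (used s) = real (used st) - 1" using s(2) by linarith
      ultimately show ?thesis using Suc.IH[of s] Suc.prems by simp
    qed
    have "measure_pmf.prob (ops (Suc n) st) ?A \<le>
       p * (\<rho> ^ n * exp (l * (real (used st) + 1 + real j - real M))) +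
       (1 - p) * (\<rho> ^ n * exp (l * (real (used st) - 1 + real j - real M)))"
      using operation_prob_le[OF u i d] by simp
    also have "\<dots> = \<rho> ^ Suc n * exp (l * (real (used st) + real j - real M))"
      by (simp add: \<rho>_def algebra_simps exp_add exp_diff exp_minus divide_inverse)
    finally show ?thesis .
  qed
qed

lemma no_rehash_prob:
  fixes \<theta> d :: real
  defines "\<kappa> \<equiv> 1 - p * ((1 - d) * (1 - exp (- \<theta>)))"
  assumes "0 \<le> \<theta>" "0 \<le> d" "d \<le> 1" "valid key st" "0 < capacity st" "(1 - d) * real (capacity st) + real n \<le> real (used st)"
  shows "measure_pmf.prob (ops n st) {s. extra s = extra st} \<le> \<kappa> ^ n * exp (\<theta> * real (free st))"
  using assms(5-7)
proof (induction n arbitrary: st)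
  case 0
  then show ?case using assms(2) by (simp add: measure_pmf.prob_le_1)
next
  case (Suc n)
  let ?A = "{s. extra s = extra st}" and ?M = "capacity st"
  define b where "b = \<kappa> ^ n * exp (\<theta> * real (free st))"
  have "0 \<le> (1 - d) * (1 - exp (- \<theta>))" "(1 - d) * (1 - exp (- \<theta>)) \<le> 1"
    using assms(2-4) by (auto intro!: mult_le_one)
  then have "p * ((1 - d) * (1 - exp (- \<theta>))) \<le> 1" using p assms(2-4) by (intro mult_le_one) auto
  then have "0 \<le> \<kappa>" by (simp add: \<kappa>_def)
  then have b: "0 \<le> b" by (simp add: b_def)
  have "0 \<le> (1 - d) * real ?M" using assms(4) by simp
  then have u: "used st > 0" using Suc.prems(3) by linarith
  have ne: "slots (hmap st) \<noteq> []" using Suc.prems(2) by (simp add: capacity_def)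
  have zero: "measure_pmf.prob (ops n s) ?A = 0" if "valid key s" "extra s > extra st" for s
    using ops_support[OF that(1)] that(2) by (intro prob_ops_eq_0) fastforce
  define del where "del i = is_deleted (slots (hmap st) ! i)" for i
  \<comment> \<open>Hitting a slot that is not deleted either consumes a free slot, which gains the
    factor \<open>exp (- \<theta>)\<close>, or forces a rehash, after which \<open>extra\<close> can
    never return to its old value.\<close>
  have at: "measure_pmf.prob (insert_at key val st i \<bind> ops n) ?A \<le> b * exp (- \<theta>) + (if del i then b * (1 - exp (- \<theta>)) else 0)"
    if i: "i \<in> {..<?M}" for i
  proof (rule prob_bind_pmf_le)
    fix s assume "s \<in> set_pmf (insert_at key val st i)"
    then consider "valid key s" "extra s > extra st" |
      "valid key s" "used s = Suc (used st)" "capacity s = ?M" "extra s = extra st"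
      "if del i then free s = free st else Suc (free s) = free st"
      using insert_at_support[OF inj Suc.prems(1), of i s val] i unfolding del_def by fastforce
    then show "measure_pmf.prob (ops n s) ?A \<le> b * exp (- \<theta>) + (if del i then b * (1 - exp (- \<theta>)) else 0)"
    proof cases
      case 1
      then show ?thesis using zero[of s] b assms(2) by simp
    next
      case 2
      have IH: "measure_pmf.prob (ops n s) ?A \<le> \<kappa> ^ n * exp (\<theta> * real (free s))"
        using Suc.IH[of s] 2 Suc.prems by simp
      show ?thesis
      proof (cases "del i")
        case True
        then show ?thesis using IH 2(5) by (simp add: b_def algebra_simps)
      next
        case False
        then have "real (free st) = real (free s) + 1" using 2(5) by auto
        then have "exp (\<theta> * real (free s)) = exp (\<theta> * real (free st)) * exp (- \<theta>)"
          by (simp add: exp_add[symmetric] algebra_simps)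
        then show ?thesis using IH False by (simp add: b_def mult.assoc)
      qed
    qed
  qed
  have D: "real (card {i \<in> {..<?M}. del i}) \<le> d * real ?M"
  proof -
    have "length (filter is_deleted (slots (hmap st))) + length (filter is_used (slots (hmap st))) \<le> ?M"
      unfolding capacity_def by (rule filter_length_disjoint) (auto simp: is_deleted_def is_used_def)
    moreover have "length (filter is_deleted (slots (hmap st))) = card {i \<in> {..<?M}. del i}"
      by (simp add: length_filter_conv_card capacity_def del_def)
    ultimately have "real (card {i \<in> {..<?M}. del i}) + real (used st) \<le> real ?M"
      by (simp add: used_def nused_def)
    then show ?thesis using Suc.prems(3) by (simp add: algebra_simps)
  qed
  have "measure_pmf.prob (ins st \<bind> ops n) ?A =
      (\<Sum>i<?M. measure_pmf.prob (insert_at key val st i \<bind> ops n) ?A) / real ?M"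
    using Suc.prems(2) unfolding random_insert_eq[OF inj Suc.prems(1) ne] bind_assoc_pmf
    by (subst prob_bind_pmf_of_set) (auto simp: lessThan_empty_iff)
  also have "\<dots> \<le> (\<Sum>i<?M. b * exp (- \<theta>) + (if del i then b * (1 - exp (- \<theta>)) else 0)) / real ?M"
    by (intro divide_right_mono sum_mono at) auto
  also have "\<dots> = b * exp (- \<theta>) + real (card {i \<in> {..<?M}. del i}) * (b * (1 - exp (- \<theta>))) / real ?M"
    using Suc.prems(2) by (simp add: sum.distrib add_divide_distrib sum.inter_filter[symmetric])
  also have "\<dots> \<le> b * exp (- \<theta>) + d * real ?M * (b * (1 - exp (- \<theta>))) / real ?M"
    using b assms(2) by (intro add_mono divide_right_mono mult_right_mono D) auto
  also have "\<dots> = b * (exp (- \<theta>) + d * (1 - exp (- \<theta>)))"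
    using Suc.prems(2) by (simp add: field_simps)
  finally have i: "measure_pmf.prob (ins st \<bind> ops n) ?A \<le> b * (exp (- \<theta>) + d * (1 - exp (- \<theta>)))" .
  have dl: "measure_pmf.prob (ops n s) ?A \<le> b" if "s \<in> set_pmf (random_delete st)" for s
  proof -
    have s: "valid key s" "Suc (used s) = used st" "capacity s = ?M" "extra s = extra st" "free s = free st"
      using random_delete_support[OF Suc.prems(1) u that] by auto
    moreover have "real (used s) = real (used st) - 1" using s(2) by linarith
    ultimately show ?thesis using Suc.IH[of s] Suc.prems by (simp add: b_def)
  qed
  have "measure_pmf.prob (ops (Suc n) st) ?A \<le> p * (b * (exp (- \<theta>) + d * (1 - exp (- \<theta>)))) + (1 - p) * b"
    using operation_prob_le[OF u i dl] by simp
  also have "\<dots> = \<kappa> * b" by (simp add: \<kappa>_def algebra_simps)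
  finally show ?case by (simp add: b_def)
qed

section \<open>From one phase to many\<close>

lemma drift_factor:
  fixes l :: real
  assumes "0 \<le> l" "l \<le> 1"
  shows "1 \<le> p * exp l + (1 - p) * exp (- l)"
    "p * exp l + (1 - p) * exp (- l) \<le> exp ((2 * p - 1) * l + l\<^sup>2)"
    "p * exp (- l) + (1 - p) * exp l \<le> 1 - (2 * p - 1) * l + l\<^sup>2"
proof -
  \<comment> \<open>The mixtures are the moment generating function, at \<open>l\<close> and at
    \<open>- l\<close>, of a step that is 1 with probability \<open>p\<close> and -1 otherwise. Its
    mean is \<open>2 * p - 1\<close>, and the square of \<open>l\<close> dominates the second-order
    terms.\<close>
  have "1 + l \<le> exp l" "1 + (- l) \<le> exp (- l)" by (rule exp_ge_add_one_self)+
  then have "2 \<le> exp l + exp (- l)" by linarith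
  moreover have "0 \<le> (2 * p - 1) * (exp l - exp (- l))"
    using p assms by (intro mult_nonneg_nonneg) auto
  ultimately show "1 \<le> p * exp l + (1 - p) * exp (- l)" by (simp add: algebra_simps)
  have m: "p * a + (1 - p) * b \<le> p * a' + (1 - p) * b'" if "a \<le> a'" "b \<le> b'" for a a' b b'
    using p that by (intro add_mono mult_left_mono) auto
  have "p * exp l + (1 - p) * exp (- l) \<le> 1 + ((2 * p - 1) * l + l\<^sup>2)"
    using m[OF exp_le_quadratic[OF assms]] by (simp add: algebra_simps)
  then show "p * exp l + (1 - p) * exp (- l) \<le> exp ((2 * p - 1) * l + l\<^sup>2)"
    using exp_ge_add_one_self order_trans by blast
  show "p * exp (- l) + (1 - p) * exp l \<le> 1 - (2 * p - 1) * l + l\<^sup>2"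
    using m[OF exp_le_quadratic(2)[OF assms] exp_le_quadratic(1)[OF assms]] by (simp add: algebra_simps)
qed

text \<open>Between two rehashes the free slots are consumed at rate almost \<open>p\<close> per operation, faster than
  the gap shrinks, namely at rate \<open>2 * p - 1\<close>. So after \<open>\<alpha> * g\<close> operations with
  \<open>1 / p < \<alpha> < 1 / (2 * p - 1)\<close> a rehash has happened but the gap is still positive.\<close>

lemma phase:
  obtains b r :: nat and d c C :: real where "0 < d" "0 < c" "0 < C"
    "\<And>st M g. valid key st \<Longrightarrow> capacity st = M \<Longrightarrow> used st + g = M \<Longrightarrow> 1 \<le> g \<Longrightarrow>
      real (2 ^ b * g) \<le> d * real M \<Longrightarrow>
      \<exists>L. L + g \<le> 2 ^ b * g \<and>
        measure_pmf.prob (ops L st) {s. \<not> (valid key s \<and> capacity s = M \<and> used s < M \<and>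
          g \<le> 2 ^ r * (M - used s) \<and> M - used s \<le> 2 ^ b * g \<and> 2 * extra st + M \<le> 2 * extra s)}
        \<le> C * exp (- c * real g)"
proof -
  define \<mu> where "\<mu> = 2 * p - 1"
  have \<mu>: "0 < \<mu>" "\<mu> < p" using p by (auto simp: \<mu>_def)
  \<comment> \<open>The midpoint of the interval from \<open>1 / p\<close> to
    \<open>1 / \<mu>\<close>, which is nonempty because \<open>\<mu> < p\<close>.\<close>
  define \<alpha> where "\<alpha> = (1 / p + 1 / \<mu>) / 2"
  have p0: "0 < p" using p by simp
  have \<alpha>: "1 < \<alpha> * p" "\<alpha> * \<mu> < 1" "0 < \<alpha>"
    using \<mu> p0 by (auto simp: \<alpha>_def field_simps intro!: add_pos_pos)
  \<comment> \<open>The tolerated fraction of deleted slots. The second bound gives up at most half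
    of the surplus of \<open>\<alpha> * p\<close> over 1, so that \<open>a > 1\<close> below; the
    first keeps enough slots used for a rehash to return to the same size.\<close>
  define d where "d = min (1 / 2) ((\<alpha> * p - 1) / (2 * (\<alpha> * p)))"
  have d: "0 < d" "d \<le> 1 / 2" using \<alpha> by (auto simp: d_def)
  define a where "a = \<alpha> * p * (1 - d)"
  have "\<alpha> * p * d \<le> \<alpha> * p * ((\<alpha> * p - 1) / (2 * (\<alpha> * p)))"
    using \<alpha> p0 by (intro mult_left_mono) (auto simp: d_def)
  also have "\<dots> = (\<alpha> * p - 1) / 2" using \<alpha> p0 by simp
  finally have a: "1 < a" using \<alpha> by (simp add: a_def algebra_simps)
  \<comment> \<open>Any positive value with \<open>1 + \<theta> < a\<close> makes \<open>c1\<close>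
    positive, by \<open>1 - exp (- \<theta>) \<ge> \<theta> / (1 + \<theta>)\<close>.
    \<open>c1\<close> is the decay per unit of gap of the probability that no rehash occurs.\<close>
  define \<theta> where "\<theta> = (a - 1) / 2"
  have \<theta>: "0 < \<theta>" using a by (simp add: \<theta>_def)
  define c1 where "c1 = a * (1 - exp (- \<theta>)) - \<theta>"
  have "exp (- \<theta>) \<le> 1 / (1 + \<theta>)"
    using exp_ge_add_one_self[of \<theta>] \<theta> by (simp add: exp_minus field_simps)
  then have "\<theta> / (1 + \<theta>) \<le> 1 - exp (- \<theta>)" using \<theta> by (simp add: field_simps)
  then have "a * (\<theta> / (1 + \<theta>)) \<le> a * (1 - exp (- \<theta>))" using a by (intro mult_left_mono) auto
  moreover have "\<theta> < a * (\<theta> / (1 + \<theta>))"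
  proof -
    have "1 + \<theta> < a" using a by (simp add: \<theta>_def field_simps)
    then have "\<theta> * (1 + \<theta>) < \<theta> * a" using \<theta> by (rule mult_strict_left_mono)
    then show ?thesis using \<theta> by (simp add: field_simps)
  qed
  ultimately have c1: "0 < c1" by (simp add: c1_def)
  \<comment> \<open>The share of the gap that the mean drift leaves after
    \<open>\<alpha> * g\<close> operations. Through \<open>l\<close>, a quarter of it pays for the
    second-order term; through \<open>r\<close>, a quarter pays for the gap that is to be preserved.
    The remaining half goes into the exponent \<open>c\<close>.\<close>
  define \<eta> where "\<eta> = 1 - \<alpha> * \<mu>"
  have \<eta>: "0 < \<eta>" using \<alpha> by (simp add: \<eta>_def)
  define l where "l = min 1 (\<eta> / (4 * \<alpha>))"
  have l: "0 < l" "l \<le> 1" "\<alpha> * l \<le> \<eta> / 4" using \<alpha> \<eta> by (auto simp: l_def min_def field_simps)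
  obtain r where r: "(1 / 2) ^ r < \<eta> / 4" using real_arch_pow_inv[of "\<eta> / 4" "1 / 2"] \<eta> by auto
  \<comment> \<open>The gap grows by at most \<open>L \<le> \<alpha> * g + 1\<close>, so afterwards
    it is at most \<open>(\<alpha> + 2) * g\<close>.\<close>
  obtain b where b: "\<alpha> + 2 < 2 ^ b" using real_arch_pow[of 2 "\<alpha> + 2"] by auto
  define c where "c = min c1 (l * \<eta> / 2)"
  have c: "0 < c" "c \<le> c1" "c \<le> l * \<eta> / 2" using c1 l \<eta> by (auto simp: c_def)
  show ?thesis
  proof (rule that[of d c "exp 2 + 1" b r])
    show "0 < d" "0 < c" "0 < exp 2 + (1::real)" using d c by (auto intro: add_pos_pos)
    fix st :: "('k, 'v) run_state" and M g
    assume st: "valid key st" "capacity st = M" "used st + g = M" "1 \<le> g" "real (2 ^ b * g) \<le> d * real M"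
    \<comment> \<open>Rounding up adds less than one operation; this is the origin of the factor
      \<open>exp 2\<close> in the overflow bound.\<close>
    define L where "L = nat \<lceil>\<alpha> * real g\<rceil>"
    have g0: "0 \<le> \<alpha> * real g" using \<alpha> by simp
    have L: "\<alpha> * real g \<le> real L" "real L \<le> \<alpha> * real g + 1"
      using g0 by (auto simp: L_def of_nat_nat)
    have "real (L + g) \<le> (\<alpha> + 2) * real g" using L st(4) by (simp add: algebra_simps)
    also have "\<dots> \<le> 2 ^ b * real g" using b by (intro mult_right_mono) auto
    finally have LgR: "real (L + g) \<le> real (2 ^ b * g)" by simp
    then have Lg: "L + g \<le> 2 ^ b * g" by (simp only: of_nat_le_iff)
    \<comment> \<open>Even \<open>L\<close> deletions in a row would leave
      \<open>(1 - d) * M\<close> used keys, as both tail bounds require.\<close>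
    have U: "(1 - d) * real M + real L \<le> real (used st)"
      using LgR st(5) arg_cong[OF st(3), of real] by (simp add: algebra_simps)
    have "real M / 2 \<le> (1 - d) * real M" using d mult_right_mono[of "1 / 2" "1 - d" "real M"] by simp
    then have "real M + 2 * real L \<le> 2 * real (used st)" using U by linarith
    then have U2: "M + 2 * L \<le> 2 * used st" by linarith
    have M0: "0 < M" using st(3,4) by simp
    \<comment> \<open>Rounding down is harmless: \<open>used s + j < M\<close> means a gap of at
      least \<open>Suc j\<close>, and \<open>g < 2 ^ r * Suc j\<close>.\<close>
    define j where "j = g div 2 ^ r"
    let ?over = "{s. capacity s \<noteq> M \<or> M \<le> used s + j}" and ?still = "{s. extra s = extra st}"
    let ?bad = "{s. \<not> (valid key s \<and> capacity s = M \<and> used s < M \<and>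
          g \<le> 2 ^ r * (M - used s) \<and> M - used s \<le> 2 ^ b * g \<and> 2 * extra st + M \<le> 2 * extra s)}"
    have sub: "?bad \<inter> set_pmf (ops L st) \<subseteq> ?over \<union> ?still"
    proof
      fix s assume s: "s \<in> ?bad \<inter> set_pmf (ops L st)"
      note S = ops_support[OF st(1), of s L]
      show "s \<in> ?over \<union> ?still"
      proof (rule ccontr)
        assume n: "s \<notin> ?over \<union> ?still"
        then have 1: "capacity s = M" "used s + j < M" "extra s \<noteq> extra st" by auto
        have "g < 2 ^ r * Suc j" unfolding j_def by (metis dividend_less_times_div mult_Suc_right zero_less_numeral zero_less_power)
        also have "\<dots> \<le> 2 ^ r * (M - used s)" using 1(2) by (intro mult_left_mono) auto
        finally have 2: "g \<le> 2 ^ r * (M - used s)" by simp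
        have "used st \<le> used s + L" using S s by blast
        then have 3: "M - used s \<le> 2 ^ b * g" using Lg st(3) by linarith
        have "extra st + (used st - L) \<le> extra s" using S s 1(3) by blast
        then have 4: "2 * extra st + M \<le> 2 * extra s" using U2 by linarith
        show False using s S 1 2 3 4 by auto
      qed
    qed
    have "measure_pmf.prob (ops L st) ?bad = measure_pmf.prob (ops L st) (?bad \<inter> set_pmf (ops L st))"
      by (simp add: measure_Int_set_pmf)
    also have "\<dots> \<le> measure_pmf.prob (ops L st) (?over \<union> ?still)"
      using sub by (intro measure_pmf.finite_measure_mono) auto
    also have "\<dots> \<le> measure_pmf.prob (ops L st) ?over + measure_pmf.prob (ops L st) ?still"
      by (rule measure_Un_le) auto
    also have "measure_pmf.prob (ops L st) ?over \<le> exp 2 * exp (- c * real g)"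
    proof -
      have gap: "real (used st) + real j - real M = real j - real g"
        using arg_cong[OF st(3), of real] by simp
      define \<rho> where "\<rho> = p * exp l + (1 - p) * exp (- l)"
      have \<rho>: "1 \<le> \<rho>" "\<rho> \<le> exp (\<mu> * l + l\<^sup>2)" using drift_factor(1,2)[of l] l by (auto simp: \<rho>_def \<mu>_def)
      have "measure_pmf.prob (ops L st) ?over \<le> \<rho> ^ L * exp (l * (real (used st) + real j - real M))"
        unfolding \<rho>_def by (rule overflow_prob) (use l \<rho> st(1,2) U2 in \<open>auto simp: \<rho>_def\<close>)
      also have "\<dots> \<le> exp (\<mu> * l + l\<^sup>2) ^ L * exp (l * (real (used st) + real j - real M))"
        using \<rho> by (intro mult_right_mono power_mono) auto
      also have "\<dots> = exp (real L * (\<mu> * l + l\<^sup>2) + l * (real j - real g))"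
        by (simp only: gap exp_of_nat_mult mult_exp_exp[symmetric])
      also have "\<dots> \<le> exp (2 - c * real g)"
      proof -
        have jr: "real j \<le> \<eta> / 4 * real g"
        proof -
          have "real j \<le> real g / 2 ^ r" unfolding j_def using of_nat_div_le_of_nat[of g "2 ^ r"] by simp
          also have "\<dots> = (1 / 2) ^ r * real g" by (simp add: power_one_over)
          also have "\<dots> \<le> \<eta> / 4 * real g" using r by (intro mult_right_mono) auto
          finally show ?thesis .
        qed
        have q: "0 \<le> \<mu> * l + l\<^sup>2" using \<mu> l by simp
        have q2: "\<mu> * l + l\<^sup>2 \<le> 2"
          using mult_le_one[of \<mu> l] power_le_one[of l 2] l \<mu> p by linarith
        have "real L * (\<mu> * l + l\<^sup>2) \<le> (\<alpha> * real g + 1) * (\<mu> * l + l\<^sup>2)"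
          using L q by (intro mult_right_mono) auto
        also have "\<dots> \<le> \<alpha> * real g * (\<mu> * l + l\<^sup>2) + 2" using q2 by (simp add: algebra_simps)
        also have "\<alpha> * real g * (\<mu> * l + l\<^sup>2) = l * real g * (\<alpha> * \<mu> + \<alpha> * l)"
          by (simp add: algebra_simps power2_eq_square)
        also have "\<dots> \<le> l * real g * (1 - \<eta> + \<eta> / 4)"
          using l by (intro mult_left_mono) (auto simp: \<eta>_def)
        finally have 1: "real L * (\<mu> * l + l\<^sup>2) \<le> l * real g * (1 - \<eta> + \<eta> / 4) + 2" by simp
        have 2: "l * real j \<le> l * (\<eta> / 4 * real g)" using jr l by (intro mult_left_mono) auto
        have 3: "c * real g \<le> l * \<eta> / 2 * real g" using c by (intro mult_right_mono) auto
        have "real L * (\<mu> * l + l\<^sup>2) + l * (real j - real g) \<le> 2 - c * real g"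
          using 1 2 3 by (simp add: algebra_simps)
        then show ?thesis by simp
      qed
      also have "\<dots> = exp 2 * exp (- c * real g)" by (simp add: mult_exp_exp)
      finally show ?thesis .
    qed
    also have "measure_pmf.prob (ops L st) ?still \<le> exp (- c * real g)"
    proof -
      define x where "x = p * ((1 - d) * (1 - exp (- \<theta>)))"
      have x: "0 \<le> x" unfolding x_def using p d \<theta> by simp
      have x1: "0 \<le> 1 - x"
      proof -
        have "(1 - d) * (1 - exp (- \<theta>)) \<le> 1" using d \<theta> by (intro mult_le_one) auto
        then have "x \<le> 1" unfolding x_def using p d \<theta> by (intro mult_le_one) auto
        then show ?thesis by simp
      qed
      have "measure_pmf.prob (ops L st) ?still \<le> (1 - x) ^ L * exp (\<theta> * real (free st))"
        unfolding x_def by (rule no_rehash_prob) (use \<theta> d st(1,2) M0 U in auto)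
      also have "\<dots> \<le> exp (- x) ^ L * exp (\<theta> * real g)"
      proof (rule mult_mono)
        show "(1 - x) ^ L \<le> exp (- x) ^ L"
          using exp_ge_add_one_self[of "- x"] x1 by (intro power_mono) auto
        have "free st \<le> g" using used_free_le[of st] st(2,3) by linarith
        then show "exp (\<theta> * real (free st)) \<le> exp (\<theta> * real g)" using \<theta> by simp
      qed auto
      also have "\<dots> = exp (\<theta> * real g - real L * x)"
        by (simp add: exp_of_nat_mult[symmetric] exp_add[symmetric])
      also have "\<dots> \<le> exp (- c * real g)"
      proof -
        have "\<alpha> * real g * x \<le> real L * x" using L x by (intro mult_right_mono) auto
        moreover have "\<alpha> * real g * x = (c1 + \<theta>) * real g" by (simp add: x_def c1_def a_def)
        moreover have "c * real g \<le> c1 * real g" using c by (intro mult_right_mono) auto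
        ultimately have "\<theta> * real g - real L * x \<le> - c * real g" by (simp add: algebra_simps)
        then show ?thesis by simp
      qed
      finally show ?thesis .
    qed
    finally have "measure_pmf.prob (ops L st) ?bad \<le> (exp 2 + 1) * exp (- c * real g)"
      by (simp add: algebra_simps)
    then show "\<exists>L. L + g \<le> 2 ^ b * g \<and> measure_pmf.prob (ops L st) ?bad \<le> (exp 2 + 1) * exp (- c * real g)"
      using Lg by blast
  qed
qed

text \<open>A union bound over \<open>K\<close> phases. As each phase changes the gap by a factor of
  at most \<open>2 ^ r\<close> downwards and \<open>2 ^ b\<close> upwards, the hypotheses on
  \<open>g\<close> guarantee that every phase starts with a gap that is at least \<open>G\<close>
  and small enough for \<open>phase\<close>. No phase takes longer than
  \<open>2 ^ (b * K) * g\<close>, which gives the time budget.\<close>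

lemma phases:
  obtains b r :: nat and d c C :: real where "0 < d" "0 < c" "0 < C"
    "\<And>st M g K G n. valid key st \<Longrightarrow> capacity st = M \<Longrightarrow> used st + g = M \<Longrightarrow> 1 \<le> G \<Longrightarrow>
      G * 2 ^ (r * K) \<le> g \<Longrightarrow> real (2 ^ (b * K) * g) \<le> d * real M \<Longrightarrow> K * 2 ^ (b * K) * g \<le> n \<Longrightarrow>
      measure_pmf.prob (ops n st) {s. 2 * extra s < 2 * extra st + K * M} \<le> real K * (C * exp (- c * real G))"
proof -
  obtain b r d c C where dcC: "0 < d" "0 < c" "0 < C" and ph:
    "\<And>st M g. valid key st \<Longrightarrow> capacity st = M \<Longrightarrow> used st + g = M \<Longrightarrow> 1 \<le> g \<Longrightarrow>
      real (2 ^ b * g) \<le> d * real M \<Longrightarrow>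
      \<exists>L. L + g \<le> 2 ^ b * g \<and>
        measure_pmf.prob (ops L st) {s. \<not> (valid key s \<and> capacity s = M \<and> used s < M \<and>
          g \<le> 2 ^ r * (M - used s) \<and> M - used s \<le> 2 ^ b * g \<and> 2 * extra st + M \<le> 2 * extra s)}
        \<le> C * exp (- c * real g)"
    by (rule phase) blast
  show ?thesis
  proof (rule that[OF dcC, of r b])
    fix st :: "('k, 'v) run_state" and M g K G n
    assume "valid key st" "capacity st = M" "used st + g = M" "1 \<le> G"
      "G * 2 ^ (r * K) \<le> g" "real (2 ^ (b * K) * g) \<le> d * real M" "K * 2 ^ (b * K) * g \<le> n"
    then show "measure_pmf.prob (ops n st) {s. 2 * extra s < 2 * extra st + K * M} \<le> real K * (C * exp (- c * real G))"
    proof (induction K arbitrary: st g n)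
      case 0
      \<comment> \<open>Operations left over after the last phase do no harm, because
        \<open>extra\<close> never decreases.\<close>
      have "measure_pmf.prob (ops n st) {s. 2 * extra s < 2 * extra st + 0 * M} = 0"
        by (rule prob_ops_eq_0) (use ops_support[OF 0(1)] in fastforce)
      then show ?case by simp
    next
      case (Suc K)
      have "G * 1 \<le> G * 2 ^ (r * Suc K)" by (intro mult_left_mono) auto
      then have Gg: "G \<le> g" using Suc.prems(5) by linarith
      have g: "1 \<le> g" using Gg Suc.prems(4) by simp
      have bb: "2 ^ b * g \<le> 2 ^ (b * Suc K) * g"
        by (intro mult_right_mono power_increasing) auto
      have "real (2 ^ b * g) \<le> real (2 ^ (b * Suc K) * g)" using bb by (simp only: of_nat_le_iff)
      also have "\<dots> \<le> d * real M" by (rule Suc.prems(6))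
      finally obtain L where L: "L + g \<le> 2 ^ b * g" and pL:
        "measure_pmf.prob (ops L st) {s. \<not> (valid key s \<and> capacity s = M \<and> used s < M \<and>
          g \<le> 2 ^ r * (M - used s) \<and> M - used s \<le> 2 ^ b * g \<and> 2 * extra st + M \<le> 2 * extra s)}
          \<le> C * exp (- c * real g)" (is "measure_pmf.prob _ ?B \<le> _")
        using ph[OF Suc.prems(1-3) g] by blast
      let ?X = "2 ^ (b * Suc K) * g"
      have n: "?X + K * ?X \<le> n" using Suc.prems(7) by (simp add: algebra_simps)
      have Ln: "n = L + (n - L)" using n L bb by linarith
      let ?A = "{s. 2 * extra s < 2 * extra st + Suc K * M}"
      have good: "measure_pmf.prob (ops (n - L) s) ?A \<le> real K * (C * exp (- c * real G))" if "s \<notin> ?B" for s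
      proof -
        define h where "h = M - used s"
        have s: "valid key s" "capacity s = M" "used s + h = M" "g \<le> 2 ^ r * h" "h \<le> 2 ^ b * g"
          "2 * extra st + M \<le> 2 * extra s" using that by (auto simp: h_def)
        have hX: "2 ^ (b * K) * h \<le> ?X"
        proof -
          have "2 ^ (b * K) * h \<le> 2 ^ (b * K) * (2 ^ b * g)" using s(5) by (intro mult_left_mono) auto
          then show ?thesis by (simp add: power_add mult_ac)
        qed
        have "measure_pmf.prob (ops (n - L) s) {t. 2 * extra t < 2 * extra s + K * M} \<le> real K * (C * exp (- c * real G))"
        proof (rule Suc.IH[OF s(1-3) Suc.prems(4)])
          have "G * 2 ^ (r * Suc K) = 2 ^ r * (G * 2 ^ (r * K))" by (simp add: power_add)
          then have "2 ^ r * (G * 2 ^ (r * K)) \<le> 2 ^ r * h"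
            using order_trans[OF Suc.prems(5) s(4)] by metis
          then show "G * 2 ^ (r * K) \<le> h" by simp
          have "real (2 ^ (b * K) * h) \<le> real ?X" using hX by (simp only: of_nat_le_iff)
          then show "real (2 ^ (b * K) * h) \<le> d * real M" using Suc.prems(6) by linarith
          have "K * (2 ^ (b * K) * h) \<le> K * ?X" using hX by (rule mult_left_mono) simp
          then show "K * 2 ^ (b * K) * h \<le> n - L" using n L bb by (simp only: mult.assoc)
        qed
        moreover have "measure_pmf.prob (ops (n - L) s) ?A \<le>
            measure_pmf.prob (ops (n - L) s) {t. 2 * extra t < 2 * extra s + K * M}"
          using s(6) by (intro measure_pmf.finite_measure_mono) auto
        ultimately show ?thesis by linarith
      qed
      have "measure_pmf.prob (ops n st) ?A \<le> measure_pmf.prob (ops L st) ?B + real K * (C * exp (- c * real G))"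
        by (subst Ln, unfold operations_add, rule prob_bind_pmf_le_bad) (use good dcC in auto)
      also have "measure_pmf.prob (ops L st) ?B \<le> C * exp (- c * real G)"
      proof (rule order_trans[OF pL])
        show "C * exp (- c * real g) \<le> C * exp (- c * real G)" using Gg dcC by simp
      qed
      finally show ?case by (simp add: algebra_simps)
    qed
  qed
qed

text \<open>The state on first reaching \<open>u\<close> used keys is good: no array above \<open>M\<close> slots has been allocated
  yet, and one of at most \<open>M div 2\<close> slots cannot hold \<open>u\<close> keys. The second term bounds the
  probability of reaching \<open>u\<close> too late, by a supermartingale that is exponential in the used count.\<close>

lemma hitting:
  fixes l :: real
  defines "\<kappa> \<equiv> p * exp (- l) + (1 - p) * exp l"
  assumes l: "0 \<le> l" "\<kappa> \<le> 1" and M: "M = 2 ^ m" "M < 2 * u" "u \<le> M" and \<epsilon>: "0 \<le> \<epsilon>"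
    and start: "\<And>st n. valid key st \<Longrightarrow> capacity st = M \<Longrightarrow> used st = u \<Longrightarrow> N \<le> n \<Longrightarrow>
      measure_pmf.prob (ops n st) {s. 2 * extra s < 2 * extra st + X} \<le> \<epsilon>"
    and st: "valid key st" "capacity st \<le> M" "used st \<le> u"
  shows "measure_pmf.prob (ops n st) {s. 2 * extra s < X} \<le> \<epsilon> + \<kappa> ^ (n - N) * exp (l * (real u - real (used st)))"
  using st
proof (induction n arbitrary: st)
  case 0
  then have "0 \<le> l * (real u - real (used st))" using l(1) by simp
  then have "1 \<le> exp (l * (real u - real (used st)))" by simp
  moreover have "\<kappa> ^ (0 - N) = 1" by simp
  ultimately show ?case
    using \<epsilon> measure_pmf.prob_le_1[of "ops 0 st" "{s. 2 * extra s < X}"] unfolding \<open>\<kappa> ^ (0 - N) = 1\<close> by linarith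
next
  case (Suc n)
  let ?A = "{s. 2 * extra s < X}"
  \<comment> \<open>An empty hashmap always inserts, so its step contributes the factor
    \<open>exp (- l)\<close> in place of \<open>\<kappa>\<close>.\<close>
  have \<kappa>l: "exp (- l) \<le> \<kappa>"
  proof -
    have "(1 - p) * exp (- l) \<le> (1 - p) * exp l" using p l(1) by (intro mult_left_mono) auto
    then show ?thesis by (simp add: \<kappa>_def algebra_simps)
  qed
  then have \<kappa>0: "0 \<le> \<kappa>" using exp_gt_zero[of "- l"] by linarith
  have e1: "1 \<le> exp (l * (real u - real (used st)))" using l(1) Suc.prems(3) by simp
  consider "Suc n \<le> N" | "N < Suc n" "used st = u" | "N < Suc n" "used st < u"
    using Suc.prems(3) by linarith
  then show ?case
  proof cases
    \<comment> \<open>Truncated subtraction makes the exponent 0 once at most \<open>N\<close>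
      operations remain, so the bound is trivial: too little time would be left for the
      phases.\<close>
    case 1
    then have "\<kappa> ^ (Suc n - N) = 1" by simp
    then show ?thesis
      using e1 \<epsilon> measure_pmf.prob_le_1[of "ops (Suc n) st" ?A] unfolding \<open>\<kappa> ^ (Suc n - N) = 1\<close> by linarith
  next
    case 2
    \<comment> \<open>The capacity is a power of two, at most \<open>M\<close>, and holds more than
      \<open>M / 2\<close> keys, so it equals \<open>M\<close>.\<close>
    have "used st \<le> capacity st" using used_free_le[of st] by simp
    then have "0 < capacity st" using 2 M by linarith
    then obtain k where k: "capacity st = 2 ^ k" using Suc.prems(1) by (auto simp: valid_def capacity_def)
    have "(2::nat) ^ m < 2 ^ Suc k" using M(1,2) 2 k \<open>used st \<le> capacity st\<close> by simp
    then have "m < Suc k" by (rule power_less_imp_less_exp[rotated]) simp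
    then have "M \<le> capacity st" unfolding k M(1) by (intro power_increasing) auto
    then have "capacity st = M" using Suc.prems(2) by simp
    then have "measure_pmf.prob (ops (Suc n) st) {s. 2 * extra s < 2 * extra st + X} \<le> \<epsilon>"
      using start[OF Suc.prems(1) _ 2(2), of "Suc n"] 2(1) by simp
    moreover have "measure_pmf.prob (ops (Suc n) st) ?A \<le> measure_pmf.prob (ops (Suc n) st) {s. 2 * extra s < 2 * extra st + X}"
      by (intro measure_pmf.finite_measure_mono) auto
    moreover have "0 \<le> \<kappa> ^ (Suc n - N) * exp (l * (real u - real (used st)))" using \<kappa>0 by simp
    ultimately show ?thesis by linarith
  next
    case 3
    define b where "b = \<kappa> ^ (n - N) * exp (l * (real u - real (used st)))"
    have b: "0 \<le> b" using \<kappa>0 by (simp add: b_def)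
    have nN: "\<kappa> ^ (Suc n - N) * exp (l * (real u - real (used st))) = \<kappa> * b"
      using 3 by (simp add: b_def Suc_diff_le)
    have i: "measure_pmf.prob (ins st \<bind> ops n) ?A \<le> \<epsilon> + b * exp (- l)"
    proof (rule prob_bind_pmf_le)
      fix s assume "s \<in> set_pmf (ins st)"
      then have s: "valid key s" "used s = Suc (used st)" "capacity s = capacity st \<or> capacity s = rehash_size (hmap st)"
        using random_insert_support[OF inj Suc.prems(1), of s val] by auto
      have "rehash_size (hmap st) \<le> M"
        unfolding M(1) by (rule rehash_size_props(3)) (use 3 M in \<open>simp add: used_def\<close>)
      then have "capacity s \<le> M" using s(3) Suc.prems(2) by auto
      then have "measure_pmf.prob (ops n s) ?A \<le> \<epsilon> + \<kappa> ^ (n - N) * exp (l * (real u - real (used s)))"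
        using Suc.IH[of s] s 3 by simp
      also have "exp (l * (real u - real (used s))) = exp (l * (real u - real (used st))) * exp (- l)"
        using s(2) by (simp add: mult_exp_exp algebra_simps)
      finally show "measure_pmf.prob (ops n s) ?A \<le> \<epsilon> + b * exp (- l)" by (simp add: b_def mult.assoc)
    qed
    show ?thesis
    proof (cases "used st = 0")
      case True
      have "measure_pmf.prob (ops (Suc n) st) ?A \<le> \<epsilon> + b * exp (- l)"
        using i by (simp add: operation_prob_empty[OF True])
      also have "\<dots> \<le> \<epsilon> + b * \<kappa>" using b \<kappa>l by (intro add_left_mono mult_left_mono) auto
      finally show ?thesis unfolding nN by (simp add: mult.commute)
    next
      case False
      then have u: "used st > 0" by simp
      have d: "measure_pmf.prob (ops n s) ?A \<le> \<epsilon> + b * exp l" if "s \<in> set_pmf (random_delete st)" for s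
      proof -
        have s: "valid key s" "Suc (used s) = used st" "capacity s = capacity st"
          using random_delete_support[OF Suc.prems(1) u that] by auto
        then have "measure_pmf.prob (ops n s) ?A \<le> \<epsilon> + \<kappa> ^ (n - N) * exp (l * (real u - real (used s)))"
          using Suc.IH[of s] Suc.prems 3 by simp
        also have "exp (l * (real u - real (used s))) = exp (l * (real u - real (used st))) * exp l"
          using s(2)[symmetric] by (simp add: mult_exp_exp algebra_simps)
        finally show ?thesis by (simp add: b_def mult.assoc)
      qed
      have "measure_pmf.prob (ops (Suc n) st) ?A \<le> p * (\<epsilon> + b * exp (- l)) + (1 - p) * (\<epsilon> + b * exp l)"
        using operation_prob_le[OF u i d] by simp
      also have "\<dots> = \<epsilon> + \<kappa> * b" by (simp add: \<kappa>_def algebra_simps)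
      finally show ?thesis unfolding nN .
    qed
  qed
qed

section \<open>Choice of the parameters and the tail bound\<close>

lemma valid_initial: "valid key \<lparr>hmap = empty_hashmap, inserted = 0, calls = 0, steps = 0\<rparr>"
  using wf_new_hashmap[of 0] by (simp add: valid_def empty_hashmap_def) (simp add: new_hashmap_def)

text \<open>Each of the \<open>m div s\<close> phases, in an array of \<open>2 ^ m\<close> slots,
  yields at least half that many extra calls. The first error term comes from the phases, the second
  from reaching the starting gap too late.\<close>

lemma calls_bound:
  obtains s :: nat and w c C q :: real where "1 \<le> s" "0 < w" "w \<le> 1 / 2" "0 < c" "0 < C" "0 < q"
    "eventually (\<lambda>m. \<forall>T. 2 ^ m \<le> w * real T \<longrightarrow>
       measure_pmf.prob (run key val p T) {st. 2 * extra st < (m div s) * 2 ^ m} \<le>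
         real m * (C * exp (- c * 2 ^ (m div 4))) + exp (- q * real T)) sequentially"
proof -
  obtain b r d c C where dcC: "0 < d" "0 < c" "0 < C" and ph:
    "\<And>st M g K G n. valid key st \<Longrightarrow> capacity st = M \<Longrightarrow> used st + g = M \<Longrightarrow> 1 \<le> G \<Longrightarrow>
      G * 2 ^ (r * K) \<le> g \<Longrightarrow> real (2 ^ (b * K) * g) \<le> d * real M \<Longrightarrow> K * 2 ^ (b * K) * g \<le> n \<Longrightarrow>
      measure_pmf.prob (ops n st) {s. 2 * extra s < 2 * extra st + K * M} \<le> real K * (C * exp (- c * real G))"
    by (rule phases) blast
  \<comment> \<open>The minimiser of the quadratic bound in \<open>drift_factor\<close>, whose value
    there is \<open>1 - l\<^sup>2\<close>.\<close>
  define l where "l = (2 * p - 1) / 2"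
  have l: "0 < l" "l \<le> 1" using p by (auto simp: l_def)
  define \<kappa> where "\<kappa> = p * exp (- l) + (1 - p) * exp l"
  have p_l: "2 * p - 1 = 2 * l" by (simp add: l_def)
  have "\<kappa> \<le> 1 + (- l\<^sup>2)"
    using drift_factor(3)[of l] l unfolding p_l by (simp add: \<kappa>_def power2_eq_square algebra_simps)
  then have \<kappa>: "\<kappa> \<le> exp (- l\<^sup>2)" "\<kappa> \<le> 1" using exp_ge_add_one_self[of "- l\<^sup>2"] zero_le_power2[of l] by linarith+
  have \<kappa>0: "0 \<le> \<kappa>" using p by (simp add: \<kappa>_def)
  \<comment> \<open>The bound \<open>1 / 2\<close> leaves at least \<open>T / 2\<close> operations
    for filling the array once the phases have their share. The bound \<open>l / 4\<close> makes the
    price \<open>exp (l * M)\<close> of starting empty cancel at most half of the exponent gained in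
    that time.\<close>
  define w where "w = min (1 / 2) (l / 4)"
  have w: "0 < w" "w \<le> 1 / 2" "l * w \<le> l\<^sup>2 / 4"
    using l by (auto simp: w_def power2_eq_square min_def intro: order_trans[OF mult_left_mono])
  \<comment> \<open>With \<open>K = m div s\<close> the exponents \<open>b * K\<close>,
    \<open>r * K\<close> and \<open>K\<close> add up to at most \<open>m / 8\<close>. From
    \<open>2 ^ (m div 2)\<close> the gap thus stays above \<open>2 ^ (m div 4)\<close> and below
    \<open>M / 2 ^ (m div 4)\<close>, hence below \<open>d * M\<close> for large
    \<open>m\<close>.\<close>
  define s where "s = 8 * (b + r + 1)"
  have "filterlim (\<lambda>m. d * 2 ^ (m div 4)) at_top sequentially"
  proof (rule filterlim_tendsto_pos_mult_at_top[OF tendsto_const dcC(1)])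
    have "filterlim (\<lambda>m::nat. m div 4) sequentially sequentially"
      unfolding filterlim_at_top
    proof
      fix z :: nat
      show "eventually (\<lambda>m. z \<le> m div 4) sequentially"
        by (rule eventually_sequentiallyI[of "4 * z"]) linarith
    qed
    moreover have "filterlim (\<lambda>n::nat. (2::real) ^ n) at_top sequentially" by real_asymp
    ultimately show "filterlim (\<lambda>m. (2::real) ^ (m div 4)) at_top sequentially"
      by (rule filterlim_compose[rotated])
  qed
  then have "eventually (\<lambda>m. 1 \<le> d * 2 ^ (m div 4)) sequentially" by (simp add: filterlim_at_top)
  then have ev: "eventually (\<lambda>m. \<forall>T. 2 ^ m \<le> w * real T \<longrightarrow>
       measure_pmf.prob (run key val p T) {st. 2 * extra st < (m div s) * 2 ^ m} \<le>
         real m * (C * exp (- c * 2 ^ (m div 4))) + exp (- (l\<^sup>2 / 4) * real T)) sequentially"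
    using eventually_ge_at_top[of 8]
  proof eventually_elim
    case (elim m)
    show ?case
    proof (intro allI impI)
      fix T :: nat assume T: "2 ^ m \<le> w * real T"
      define K where "K = m div s"
      define g where "g = (2::nat) ^ (m div 2)"
      define M where "M = (2::nat) ^ m"
      have "8 * (b * K) + 8 * (r * K) + 8 * K = s * K" by (simp add: s_def algebra_simps)
      also have "\<dots> \<le> m" by (simp add: K_def)
      finally have K: "8 * (b * K) + 8 * (r * K) + 8 * K \<le> m" .
      have gM: "2 * g < M"
      proof -
        have "2 * g = 2 ^ Suc (m div 2)" by (simp add: g_def)
        also have "\<dots> < M" unfolding M_def using elim(2) by (intro power_strict_increasing) auto
        finally show ?thesis .
      qed
      have Gg: "2 ^ (m div 4) * 2 ^ (r * K) \<le> g"
        unfolding g_def power_add[symmetric] using K elim(2) by (intro power_increasing) auto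
      have bg: "2 ^ (m div 4) * (2 ^ (b * K) * g) \<le> M"
        unfolding g_def M_def power_add[symmetric] using K by (intro power_increasing) auto
      have "real (2 ^ (b * K) * g) \<le> d * 2 ^ (m div 4) * real (2 ^ (b * K) * g)"
        using mult_right_mono[OF elim(1), of "real (2 ^ (b * K) * g)"] by simp
      also have "\<dots> = d * real (2 ^ (m div 4) * (2 ^ (b * K) * g))" by simp
      also have "\<dots> \<le> d * real M" using bg dcC(1) by (intro mult_left_mono) (simp_all only: of_nat_le_iff less_imp_le)
      finally have dM: "real (2 ^ (b * K) * g) \<le> d * real M" .
      define N where "N = K * 2 ^ (b * K) * g"
      have NM: "N \<le> M"
      proof -
        have "K \<le> m div 4" using K by linarith
        also have "\<dots> \<le> 2 ^ (m div 4)" using less_exp[of "m div 4"] by simp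
        finally have "K * (2 ^ (b * K) * g) \<le> 2 ^ (m div 4) * (2 ^ (b * K) * g)" by (rule mult_right_mono) simp
        then show ?thesis using bg unfolding N_def mult.assoc by (rule order_trans)
      qed
      have MT: "real M \<le> w * real T" using T by (simp add: M_def)
      also have "\<dots> \<le> 1 / 2 * real T" using w(2) by (intro mult_right_mono) auto
      finally have MT2: "real M \<le> real T / 2" by simp
      let ?\<epsilon> = "real K * (C * exp (- c * real (2 ^ (m div 4))))"
      have "measure_pmf.prob (run key val p T) {s. 2 * extra s < K * M} \<le>
         ?\<epsilon> + \<kappa> ^ (T - N) * exp (l * (real (M - g) - real (used (\<lparr>hmap = empty_hashmap, inserted = 0, calls = 0, steps = 0\<rparr> :: ('k, 'v) run_state))))"
        unfolding run_eq_operations \<kappa>_def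
      proof (rule hitting[OF _ _ M_def])
        show "0 \<le> l" using l by simp
        show "p * exp (- l) + (1 - p) * exp l \<le> 1" using \<kappa> by (simp add: \<kappa>_def)
        show "M < 2 * (M - g)" "M - g \<le> M" using gM by auto
        show "0 \<le> ?\<epsilon>" using dcC by simp
        show "valid key \<lparr>hmap = empty_hashmap, inserted = 0, calls = 0, steps = 0\<rparr>" by (rule valid_initial)
        show "capacity \<lparr>hmap = empty_hashmap, inserted = 0, calls = 0, steps = 0\<rparr> \<le> M"
          by (simp add: capacity_def empty_hashmap_def new_hashmap_def)
        show "used \<lparr>hmap = empty_hashmap, inserted = 0, calls = 0, steps = 0\<rparr> \<le> M - g"
          by (simp add: used_def nused_def empty_hashmap_def new_hashmap_def)
        fix st :: "('k, 'v) run_state" and n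
        assume st: "valid key st" "capacity st = M" "used st = M - g" "N \<le> n"
        show "measure_pmf.prob (ops n st) {s. 2 * extra s < 2 * extra st + K * M} \<le> ?\<epsilon>"
          by (rule ph[OF st(1,2) _ _ Gg dM]) (use st gM N_def in auto)
      qed
      also have "real K * (C * exp (- c * real (2 ^ (m div 4)))) \<le> real m * (C * exp (- c * 2 ^ (m div 4)))"
        using dcC by (intro mult_mono) (auto simp: K_def)
      also have "\<kappa> ^ (T - N) * exp (l * (real (M - g) - real (used (\<lparr>hmap = empty_hashmap, inserted = 0, calls = 0, steps = 0\<rparr> :: ('k, 'v) run_state)))) \<le> exp (- (l\<^sup>2 / 4) * real T)"
      proof -
        have "\<kappa> ^ (T - N) \<le> exp (- l\<^sup>2) ^ (T - N)" using \<kappa> \<kappa>0 by (intro power_mono) auto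
        also have "\<dots> = exp (- (l\<^sup>2 * real (T - N)))" by (simp add: exp_of_nat_mult[symmetric] mult.commute)
        also have "\<dots> \<le> exp (- (l\<^sup>2 * (real T / 2)))"
        proof -
          have "real T / 2 \<le> real (T - N)" using NM MT2 by linarith
          then have "l\<^sup>2 * (real T / 2) \<le> l\<^sup>2 * real (T - N)" by (rule mult_left_mono) simp
          then show ?thesis by (simp only: exp_le_cancel_iff neg_le_iff_le)
        qed
        finally have 1: "\<kappa> ^ (T - N) \<le> exp (- (l\<^sup>2 * (real T / 2)))" .
        have "l * (real (M - g) - real (used (\<lparr>hmap = empty_hashmap, inserted = 0, calls = 0, steps = 0\<rparr> :: ('k, 'v) run_state))) \<le> l * (w * real T)"
          using l MT by (intro mult_left_mono) auto
        also have "\<dots> \<le> l\<^sup>2 / 4 * real T"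
          using mult_right_mono[OF w(3), of "real T"] by (simp add: mult.assoc)
        finally have 2: "exp (l * (real (M - g) - real (used (\<lparr>hmap = empty_hashmap, inserted = 0, calls = 0, steps = 0\<rparr> :: ('k, 'v) run_state)))) \<le> exp (l\<^sup>2 / 4 * real T)" by simp
        have "\<kappa> ^ (T - N) * exp (l * (real (M - g) - real (used (\<lparr>hmap = empty_hashmap, inserted = 0, calls = 0, steps = 0\<rparr> :: ('k, 'v) run_state)))) \<le>
            exp (- (l\<^sup>2 * (real T / 2))) * exp (l\<^sup>2 / 4 * real T)"
          using 1 2 by (intro mult_mono) auto
        also have "\<dots> = exp (- (l\<^sup>2 / 4) * real T)" by (simp add: mult_exp_exp algebra_simps)
        finally show ?thesis .
      qed
      finally show "measure_pmf.prob (run key val p T) {st. 2 * extra st < (m div s) * 2 ^ m} \<le>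
         real m * (C * exp (- c * 2 ^ (m div 4))) + exp (- (l\<^sup>2 / 4) * real T)"
        by (simp add: K_def M_def)
    qed
  qed
  show ?thesis
    by (rule that[OF _ w(1,2) dcC(2,3) _ ev]) (use l in \<open>auto simp: s_def\<close>)
qed

text \<open>The array size is taken as the largest power of two up to \<open>w * T\<close>, within a
  factor 2 of it. The phase errors decay like the exponential of a power 1/4 of \<open>T\<close>;
  lowering that power to 1/8 absorbs the polynomial prefactor and all constants.\<close>

lemma calls_tail:
  obtains C\<^sub>0 :: real where "0 < C\<^sub>0"
    "eventually (\<lambda>T. measure_pmf.prob (run key val p T) {st. \<not> C\<^sub>0 * (real T * ln (real T)) \<le> real (calls st)}
       \<le> exp (- (real T powr (1 / 8)))) sequentially"
proof -
  obtain s w c C q where k: "1 \<le> s" "0 < w" "w \<le> 1 / 2" "0 < c" "0 < C" "0 < q" and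
    ev: "eventually (\<lambda>m. \<forall>T. 2 ^ m \<le> w * real T \<longrightarrow>
       measure_pmf.prob (run key val p T) {st. 2 * extra st < (m div s) * 2 ^ m} \<le>
         real m * (C * exp (- c * 2 ^ (m div 4))) + exp (- q * real T)) sequentially"
    by (rule calls_bound) blast
  define m where "m T = nat \<lfloor>log 2 (w * real T)\<rfloor>" for T :: nat
  have m_lim: "filterlim m sequentially sequentially"
  proof -
    have "filterlim (\<lambda>T::nat. log 2 (w * real T)) at_top sequentially"
      using k(2) by real_asymp
    then show ?thesis unfolding m_def
      by (intro filterlim_compose[OF filterlim_nat_sequentially] filterlim_compose[OF filterlim_floor_sequentially])
  qed
  \<comment> \<open>\<open>w / 2\<close> appears because \<open>2 ^ m\<close> may be as small as
    half of \<open>w * T\<close>, and the last factor 1/2 because \<open>m div 4\<close> falls short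
    of \<open>m / 4\<close> by less than 1.\<close>
  define c1 where "c1 = c * ((w / 2) powr (1 / 4) / 2)"
  have c1: "0 < c1" using k by (simp add: c1_def)
  have ev2: "eventually (\<lambda>T::nat. real T * (C * exp (- (c1 * real T powr (1 / 4)))) + exp (- (q * real T)) \<le> exp (- (real T powr (1 / 8)))) sequentially"
    using c1 k by real_asymp
  have ev3: "eventually (\<lambda>T::nat. ln (real T) / 2 \<le> ln (w * real T) - 1) sequentially"
    using k by real_asymp
  have ev4: "eventually (\<lambda>T::nat. 1 \<le> w * real T) sequentially"
    using k by real_asymp
  show ?thesis
  \<comment> \<open>The factor \<open>16 * s\<close> collects the losses in
    \<open>m div s \<ge> m / (2 * s)\<close>, \<open>m \<ge> ln T / 2\<close> and
    \<open>2 ^ m \<ge> w * T / 2\<close>, and the 2 in \<open>2 * extra st\<close>.\<close>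
  proof (rule that[of "w / (16 * real s)"])
    show "0 < w / (16 * real s)" using k by simp
    show "eventually (\<lambda>T. measure_pmf.prob (run key val p T) {st. \<not> w / (16 * real s) * (real T * ln (real T)) \<le> real (calls st)}
       \<le> exp (- (real T powr (1 / 8)))) sequentially"
      using eventually_compose_filterlim[OF ev m_lim] ev2 ev3 ev4
        eventually_compose_filterlim[OF eventually_ge_at_top[of "2 * s"] m_lim] eventually_ge_at_top[of 1]
    proof eventually_elim
      case (elim T)
      have T0: "0 < w * real T" using elim(4) by simp
      have f0: "0 \<le> log 2 (w * real T)" using elim(4) by simp
      have mr: "real (m T) \<le> log 2 (w * real T)" "log 2 (w * real T) < real (m T) + 1"
        using f0 unfolding m_def by (auto simp: of_nat_nat)
      have "2 powr real (m T) \<le> w * real T" using mr(1) T0 by (simp add: le_log_iff)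
      then have m1: "2 ^ m T \<le> w * real T" by (simp add: powr_realpow)
      have "w * real T < 2 powr (real (m T) + 1)" using mr(2) T0 by (simp add: log_less_iff)
      then have m2: "w * real T < 2 * 2 ^ m T" by (simp add: powr_realpow powr_add)
      have wT: "w * real T \<le> real T" using k mult_right_mono[of w 1 "real T"] by simp
      have mT: "real (m T) \<le> real T"
        using of_nat_less_two_power[of "m T", where 'a = real] m1 wT by linarith
      have pw: "c1 * real T powr (1 / 4) \<le> c * 2 ^ (m T div 4)"
      proof -
        have "(w * real T / 2) powr (1 / 4) \<le> (2 ^ m T) powr (1 / 4)"
          using m2 T0 by (intro powr_mono2) auto
        also have "\<dots> = 2 powr (real (m T) / 4)" by (simp add: powr_realpow[symmetric] powr_powr)
        also have "\<dots> \<le> 2 powr (real (m T div 4) + 1)" by (intro powr_mono) auto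
        also have "\<dots> = 2 * 2 ^ (m T div 4)" by (simp add: powr_add powr_realpow)
        finally have "(w * real T / 2) powr (1 / 4) \<le> 2 * 2 ^ (m T div 4)" .
        moreover have "(w * real T / 2) powr (1 / 4) = (w / 2) powr (1 / 4) * real T powr (1 / 4)"
          using k powr_mult[of "w / 2" "real T" "1 / 4"] by (simp add: mult.commute)
        ultimately have "(w / 2) powr (1 / 4) / 2 * real T powr (1 / 4) \<le> 2 ^ (m T div 4)" by simp
        then have "c * ((w / 2) powr (1 / 4) / 2 * real T powr (1 / 4)) \<le> c * 2 ^ (m T div 4)"
          using k by (intro mult_left_mono) auto
        then show ?thesis by (simp add: c1_def mult.assoc)
      qed
      have "measure_pmf.prob (run key val p T) {st. \<not> w / (16 * real s) * (real T * ln (real T)) \<le> real (calls st)}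
        \<le> measure_pmf.prob (run key val p T) {st. 2 * extra st < (m T div s) * 2 ^ m T}"
      proof (rule measure_pmf.finite_measure_mono)
        have "w / (16 * real s) * (real T * ln (real T)) \<le> real (calls st)"
          if "\<not> 2 * extra st < (m T div s) * 2 ^ m T" for st :: "('k, 'v) run_state"
        proof -
          from that have "(m T div s) * 2 ^ m T \<le> 2 * extra st" by simp
          then have "real ((m T div s) * 2 ^ m T) \<le> real (2 * extra st)" by (simp only: of_nat_le_iff)
          then have 1: "real (m T div s) * 2 ^ m T \<le> 2 * real (calls st)" by (simp add: extra_def)
          have "m T < s * Suc (m T div s)" using k(1) by (simp add: dividend_less_times_div)
          then have "real (m T) < real s * (real (m T div s) + 1)"
            by (metis of_nat_Suc of_nat_less_iff of_nat_mult add.commute)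
          then have "real (m T) / 2 \<le> real s * real (m T div s)"
            using elim(5) by (simp add: algebra_simps)
          then have 2: "real (m T) / (2 * real s) \<le> real (m T div s)" using k(1) by (simp add: field_simps)
          have "ln (w * real T) \<le> log 2 (w * real T)"
          proof -
            have "ln (w * real T) * ln 2 \<le> ln (w * real T) * 1"
              using elim(4) ln_2_less_1 by (intro mult_left_mono) auto
            then show ?thesis by (simp add: log_def field_simps)
          qed
          then have "ln (real T) / 2 \<le> real (m T)" using mr(2) elim(3) by linarith
          then have 3: "ln (real T) / (4 * real s) \<le> real (m T) / (2 * real s)" using k(1) by (simp add: field_simps)
          have lnT: "0 \<le> ln (real T) / (4 * real s)" using elim(6) by simp
          have "ln (real T) / (4 * real s) * (w * real T / 2) \<le> real (m T div s) * 2 ^ m T"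
            using 2 3 m2 lnT T0 by (intro mult_mono) auto
          also note 1
          finally show ?thesis using k(1) by (simp add: field_simps)
        qed
        then show "{st :: ('k, 'v) run_state. \<not> w / (16 * real s) * (real T * ln (real T)) \<le> real (calls st)} \<subseteq> {st. 2 * extra st < (m T div s) * 2 ^ m T}"
          by blast
      qed simp
      also have "\<dots> \<le> real (m T) * (C * exp (- c * 2 ^ (m T div 4))) + exp (- q * real T)"
        using elim(1) m1 by blast
      also have "\<dots> \<le> real T * (C * exp (- (c1 * real T powr (1 / 4)))) + exp (- (q * real T))"
        using pw mT k by (intro add_mono mult_mono) auto
      also have "\<dots> \<le> exp (- (real T powr (1 / 8)))" by (rule elim(2))
      finally show ?case .
    qed
  qed
qed

end

theorem theorem1:
  fixes p :: real and key :: "nat \<Rightarrow> 'k" and val :: "nat \<Rightarrow> 'v"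
  assumes "1 / 2 < p" and "p < 1"
    and "inj key"
  shows "(\<exists>C>0. superpoly_high_prob (run key val p)
             (\<lambda>T st. real (calls st) \<ge> C * (real T * ln (real T)))) \<and>
         (\<lambda>T. measure_pmf.expectation (run key val p T) (\<lambda>st. real (steps st)))
             \<in> \<Omega>(\<lambda>T. real T * ln (real T))"
proof -
  interpret random_hashmap key val p by unfold_locales (use assms in auto)
  obtain C\<^sub>0 :: real where C: "0 < C\<^sub>0"
    "eventually (\<lambda>T. measure_pmf.prob (run key val p T) {st. \<not> C\<^sub>0 * (real T * ln (real T)) \<le> real (calls st)}
       \<le> exp (- (real T powr (1 / 8)))) sequentially"
    by (rule calls_tail)
  have "superpoly_high_prob (run key val p) (\<lambda>T st. real (calls st) \<ge> C\<^sub>0 * (real T * ln (real T)))"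
    unfolding superpoly_high_prob_def using C(2) by (intro exI[of _ "1 / 8"]) auto
  moreover have "(\<lambda>T. measure_pmf.expectation (run key val p T) (\<lambda>st. real (steps st)))
             \<in> \<Omega>(\<lambda>T. real T * ln (real T))"
  \<comment> \<open>Eventually the lower bound on calls fails with probability at most 1/2, so half
    of \<open>C\<^sub>0\<close> survives in the expectation.\<close>
  proof (rule landau_omega.bigI[of "C\<^sub>0 / 2"])
    show "0 < C\<^sub>0 / 2" using C by simp
    have "eventually (\<lambda>T::nat. exp (- (real T powr (1 / 8))) \<le> 1 / 2) sequentially"
      by real_asymp
    then show "eventually (\<lambda>T. norm (measure_pmf.expectation (run key val p T) (\<lambda>st. real (steps st)))
        \<ge> C\<^sub>0 / 2 * norm (real T * ln (real T))) sequentially"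
      using C(2) eventually_ge_at_top[of 1]
    proof eventually_elim
      case (elim T)
      let ?R = "run key val p T" and ?a = "C\<^sub>0 * (real T * ln (real T))"
      have nn: "0 \<le> real T * ln (real T)" using elim(3) by simp
      have "measure_pmf.prob ?R {st. \<not> ?a \<le> real (steps st)} =
          measure_pmf.prob ?R ({st. \<not> ?a \<le> real (steps st)} \<inter> set_pmf ?R)"
        by (simp add: measure_Int_set_pmf)
      also have "\<dots> \<le> measure_pmf.prob ?R {st. \<not> ?a \<le> real (calls st)}"
        using run_finite_steps[of key val p T] by (intro measure_pmf.finite_measure_mono) force+
      finally have "1 / 2 \<le> 1 - measure_pmf.prob ?R {st. \<not> ?a \<le> real (steps st)}"
        using elim by linarith
      then have "?a * (1 / 2) \<le> ?a * (1 - measure_pmf.prob ?R {st. \<not> ?a \<le> real (steps st)})"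
        using nn C(1) by (intro mult_left_mono) auto
      also have "\<dots> \<le> measure_pmf.expectation ?R (\<lambda>st. real (steps st))"
        by (rule expectation_ge) (use run_finite_steps[of key val p T] nn C(1) in auto)
      finally show ?case using nn by simp
    qed
  qed
  ultimately show ?thesis using C(1) by blast
qed

end
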